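(* Let $Y_i=\sum_{s}\ell_{is}\partial_s$ ($i\in\{1,\ldots,n\}$, $\ell\in\mathfrak{gl}(n,\mathbb{R}^{n*})$) be $n$ mutually commuting linear vector fields in $\mathbb{R}^n$ with $D=\det\ell\neq0$, and let $\Lambda=\sum_{i<j}\alpha^{ij}\,Y_i\wedge Y_j$ with $\alpha^{ij}\in\mathbb{R}$, $\alpha^{ji}=-\alpha^{ij}$. Set $X_i=\sum_{j\neq i}\alpha^{ij}Y_j$ and $\delta_i=\operatorname{div}X_i$. For $r\in\mathbb{N}$ let $E_r=\mathcal{S}^r\mathbb{R}^{n*}$ be the real finite-dimensional vector space of homogeneous polynomials of degree $r$ on $\mathbb{R}^n$, and let $\vec{X}_\delta=(X_1-\delta_1\operatorname{id},\ldots,X_n-\delta_n\operatorname{id})$, an $n$-tuple of commuting linear operators on $E_r$. Then the Lichnerowicz-Poisson cohomology space $LH^{*r}(\mathcal{P},\Lambda)$ of $\Lambda$ over the potential cochains coincides with the Koszul cohomology space associated with $\vec{X}_\delta$ on $E_r$: $$LH^{*r}(\mathcal{P},\Lambda)\simeq KH^*(\vec{X}_\delta,E_r).$$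
   Context: Potential formal cochains: $\mathcal{P}=D^{-1}\bigoplus_{p=0}^n\mathbb{R}[[x_1,\ldots,x_n]]\otimes\bigwedge^p\langle Y_1,\ldots,Y_n\rangle$, with homogeneous components $\mathcal{P}^{pr}=D^{-1}\mathcal{S}^r\mathbb{R}^{n*}\otimes\bigwedge^p\langle Y_1,\ldots,Y_n\rangle$. The operator $\partial_\Lambda=[\Lambda,\cdot]_{\mathrm{SN}}$ (Schouten-Nijenhuis bracket, with the convention $[Y_i\wedge Y_j,f]_{\mathrm{SN}}=(Y_jf)Y_i-(Y_if)Y_j$ and $[\Lambda,fQ]_{\mathrm{SN}}=[\Lambda,f]_{\mathrm{SN}}\wedge Q+f[\Lambda,Q]_{\mathrm{SN}}$) is a differential on $\mathcal{P}$ mapping $\mathcal{P}^{pr}$ into $\mathcal{P}^{p+1,r}$. One sets $LH^{pr}(\mathcal{P},\Lambda)=\ker(\partial_\Lambda:\mathcal{P}^{pr}\to\mathcal{P}^{p+1,r})/\operatorname{im}(\partial_\Lambda:\mathcal{P}^{p-1,r}\to\mathcal{P}^{pr})$ and $LH^{*r}(\mathcal{P},\Lambda)=\bigoplus_{p=0}^nLH^{pr}(\mathcal{P},\Lambda)$. Koszul cohomology: for commuting linear operators $\vec{Z}=(Z_1,\ldots,Z_n)$ on a vector space $E$ over a field $\mathbb{F}$, let $\bigwedge=\bigwedge_n\langle\vec\eta\rangle$ be the Grassmann algebra over $\mathbb{F}$ on generators $\eta_1,\ldots,\eta_n$ and $e_{\eta_k}$ the operator of left multiplication by $\eta_k$.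 The Koszul cochain complex is $0\to E\to E\otimes\bigwedge^1\to\cdots\to E\otimes\bigwedge^n\to0$ with differential $\mathcal{K}_{\vec Z}=\sum_kZ_k\otimes e_{\eta_k}$, and $KH^*(\vec{Z},E)$ is its cohomology. *)

theory Defs
  imports
    "HOL-Analysis.Determinants"
    "HOL-Library.Poly_Mapping"
    "HOL-Library.Function_Algebras"
    "HOL-Library.FuncSet"
    "HOL-Computational_Algebra.Fraction_Field"
begin

section \<open>Vector spaces as explicit carriers, quotients, direct sums, isomorphisms\<close>

record ('f, 'v) vspace =
  vcarrier :: "'v set"
  vadd :: "'v \<Rightarrow> 'v \<Rightarrow> 'v"
  vscale :: "'f \<Rightarrow> 'v \<Rightarrow> 'v"

text \<open>The quotient \<open>Z / B\<close> of a subspace \<open>Z\<close> by a subspace \<open>B \<subseteq> Z\<close>. Its elements are the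
  cosets \<open>z + B\<close>; adding \<open>B\<close> to \<open>c \<cdot> S\<close> makes the scalar multiple a coset also for \<open>c = 0\<close>.\<close>

definition quot_space ::
    "('f \<Rightarrow> 'v \<Rightarrow> 'v) \<Rightarrow> 'v::ab_group_add set \<Rightarrow> 'v set \<Rightarrow> ('f, 'v set) vspace" where
  "quot_space smul Z B =
    \<lparr> vcarrier = (\<lambda>z. (\<lambda>b. z + b) ` B) ` Z,
      vadd = (\<lambda>S T. {s + t | s t. s \<in> S \<and> t \<in> T}),
      vscale = (\<lambda>c S. {smul c s + b | s b. s \<in> S \<and> b \<in> B}) \<rparr>"

definition direct_sum :: "'i set \<Rightarrow> ('i \<Rightarrow> ('f, 'v) vspace) \<Rightarrow> ('f, 'i \<Rightarrow> 'v) vspace" where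
  "direct_sum A V =
    \<lparr> vcarrier = (\<Pi>\<^sub>E i\<in>A. vcarrier (V i)),
      vadd = (\<lambda>u v. \<lambda>i\<in>A. vadd (V i) (u i) (v i)),
      vscale = (\<lambda>c u. \<lambda>i\<in>A. vscale (V i) c (u i)) \<rparr>"

definition linear_iso :: "('f, 'v) vspace \<Rightarrow> ('f, 'w) vspace \<Rightarrow> ('v \<Rightarrow> 'w) \<Rightarrow> bool" where
  "linear_iso V W \<phi> \<longleftrightarrow>
    bij_betw \<phi> (vcarrier V) (vcarrier W) \<and>
    (\<forall>u\<in>vcarrier V. \<forall>v\<in>vcarrier V. \<phi> (vadd V u v) = vadd W (\<phi> u) (\<phi> v)) \<and>
    (\<forall>c. \<forall>u\<in>vcarrier V. \<phi> (vscale V c u) = vscale W c (\<phi> u))"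


section \<open>Cohomology of a cochain complex\<close>

text \<open>The complex consists of subspaces \<open>C 0, C 1, \<dots>\<close> of one ambient space together with an
  operator \<open>d\<close> mapping \<open>C p\<close> to \<open>C (p + 1)\<close>; the term preceding \<open>C 0\<close> is \<open>0\<close>.\<close>

definition cocycles :: "(nat \<Rightarrow> 'v::ab_group_add set) \<Rightarrow> ('v \<Rightarrow> 'v) \<Rightarrow> nat \<Rightarrow> 'v set" where
  "cocycles C d p = {w \<in> C p. d w = 0}"

definition coboundaries :: "(nat \<Rightarrow> 'v::ab_group_add set) \<Rightarrow> ('v \<Rightarrow> 'v) \<Rightarrow> nat \<Rightarrow> 'v set" where
  "coboundaries C d p = (case p of 0 \<Rightarrow> {0} | Suc q \<Rightarrow> d ` C q)"

definition cohomology ::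
    "('f \<Rightarrow> 'v \<Rightarrow> 'v) \<Rightarrow> (nat \<Rightarrow> 'v::ab_group_add set) \<Rightarrow> ('v \<Rightarrow> 'v) \<Rightarrow> nat
      \<Rightarrow> ('f, 'v set) vspace" where
  "cohomology smul C d p = quot_space smul (cocycles C d p) (coboundaries C d p)"


section \<open>Grassmann algebras with coefficients\<close>

text \<open>An element \<open>\<Sum>\<^sub>I w\<^sub>I \<otimes> \<eta>\<^sub>I\<close> of \<open>E \<otimes> \<And>\<langle>\<eta>\<rangle>\<close>, where \<open>\<eta>\<^sub>I = \<eta>\<^bsub>i1\<^esub> \<and> \<dots> \<and> \<eta>\<^bsub>ip\<^esub>\<close> for
  \<open>I = {i1 < \<dots> < ip}\<close>, is encoded by its coefficient family \<open>w :: 'n set \<Rightarrow> 'v\<close>. For disjoint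
  \<open>I, J\<close> one has \<open>\<eta>\<^sub>I \<and> \<eta>\<^sub>J = (- 1)\<^bsup>inversions I J\<^esup> \<eta>\<^bsub>I \<union> J\<^esub>\<close>.\<close>

definition inversions :: "'n::linorder set \<Rightarrow> 'n set \<Rightarrow> nat" where
  "inversions I J = card {(i, j). i \<in> I \<and> j \<in> J \<and> j < i}"

definition signed :: "nat \<Rightarrow> 'v::ab_group_add \<Rightarrow> 'v" where
  "signed k x = (if even k then x else - x)"

definition wedge ::
    "('n::{finite,linorder} set \<Rightarrow> 'a::comm_ring_1) \<Rightarrow> ('n set \<Rightarrow> 'a) \<Rightarrow> 'n set \<Rightarrow> 'a" where
  "wedge u v K = (\<Sum>I\<in>Pow K. signed (inversions I (K - I)) (u I * v (K - I)))"

definition scalar_form :: "'a::comm_ring_1 \<Rightarrow> 'n set \<Rightarrow> 'a" where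
  "scalar_form a I = (if I = {} then a else 0)"

text \<open>\<open>id \<otimes> e\<close>, with \<open>e\<close> the left multiplication by the \<open>k\<close>-th generator.\<close>

definition gen_mult ::
    "'n::{finite,linorder} \<Rightarrow> ('n set \<Rightarrow> 'v::ab_group_add) \<Rightarrow> 'n set \<Rightarrow> 'v" where
  "gen_mult k w K = (if k \<in> K then signed (inversions {k} (K - {k})) (w (K - {k})) else 0)"

text \<open>Left and right derivative with respect to the \<open>s\<close>-th generator.\<close>

definition left_deriv ::
    "'n::{finite,linorder} \<Rightarrow> ('n set \<Rightarrow> 'v::ab_group_add) \<Rightarrow> 'n set \<Rightarrow> 'v" where
  "left_deriv s w I = (if s \<in> I then 0 else signed (inversions {s} I) (w (insert s I)))"

definition right_deriv ::
    "'n::{finite,linorder} \<Rightarrow> ('n set \<Rightarrow> 'v::ab_group_add) \<Rightarrow> 'n set \<Rightarrow> 'v" where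
  "right_deriv s w I = (if s \<in> I then 0 else signed (inversions I {s}) (w (insert s I)))"


section \<open>Koszul cohomology\<close>

definition koszul_cochains ::
    "'v::ab_group_add set \<Rightarrow> nat \<Rightarrow> ('n::{finite,linorder} set \<Rightarrow> 'v) set" where
  "koszul_cochains E p = {w. \<forall>I. if card I = p then w I \<in> E else w I = 0}"

definition koszul_differential ::
    "('n::{finite,linorder} \<Rightarrow> 'v::ab_group_add \<Rightarrow> 'v) \<Rightarrow> ('n set \<Rightarrow> 'v) \<Rightarrow> 'n set \<Rightarrow> 'v" where
  "koszul_differential Z w = (\<Sum>k\<in>UNIV. gen_mult k (\<lambda>I. Z k (w I)))"

definition KH ::
    "('f::field \<Rightarrow> 'v::ab_group_add \<Rightarrow> 'v) \<Rightarrow> ('n::{finite,linorder} \<Rightarrow> 'v \<Rightarrow> 'v) \<Rightarrow> 'v set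
      \<Rightarrow> ('f, nat \<Rightarrow> ('n set \<Rightarrow> 'v) set) vspace" where
  "KH smul Z E =
    direct_sum {..CARD('n)}
      (cohomology (\<lambda>c w I. smul c (w I)) (koszul_cochains E) (koszul_differential Z))"

definition commuting_linear_operators ::
    "('f::field \<Rightarrow> 'v::ab_group_add \<Rightarrow> 'v) \<Rightarrow> 'v set \<Rightarrow> ('n \<Rightarrow> 'v \<Rightarrow> 'v) \<Rightarrow> bool" where
  "commuting_linear_operators smul E Z \<longleftrightarrow>
    (\<forall>i. \<forall>u\<in>E. Z i u \<in> E) \<and>
    (\<forall>i. \<forall>u\<in>E. \<forall>v\<in>E. Z i (u + v) = Z i u + Z i v) \<and>
    (\<forall>i c. \<forall>u\<in>E. Z i (smul c u) = smul c (Z i u)) \<and>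
    (\<forall>i j. \<forall>u\<in>E. Z i (Z j u) = Z j (Z i u))"


section \<open>Polynomials and rational functions in the variables indexed by \<open>'n\<close>\<close>

type_synonym 'n mpoly = "('n \<Rightarrow>\<^sub>0 nat) \<Rightarrow>\<^sub>0 real"

definition poly_scale :: "real \<Rightarrow> 'n mpoly \<Rightarrow> 'n mpoly" where
  "poly_scale c f = Poly_Mapping.single 0 c * f"

text \<open>The space \<open>\<S>\<^sup>r \<real>\<^sup>n\<^sup>*\<close> of homogeneous polynomials of degree \<open>r\<close>.\<close>

definition hom_polys :: "nat \<Rightarrow> 'n::finite mpoly set" where
  "hom_polys r = {f. \<forall>m\<in>Poly_Mapping.keys f. (\<Sum>i\<in>UNIV. Poly_Mapping.lookup m i) = r}"

definition pderiv_poly :: "'n \<Rightarrow> 'n mpoly \<Rightarrow> 'n mpoly" where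
  "pderiv_poly s f =
    (\<Sum>m\<in>Poly_Mapping.keys f.
      Poly_Mapping.single (m - Poly_Mapping.single s 1)
        (of_nat (Poly_Mapping.lookup m s) * Poly_Mapping.lookup f m))"

lemma pderiv_poly_add: "pderiv_poly s (f + g) = pderiv_poly s f + pderiv_poly s g"
  unfolding pderiv_poly_def
  by (rule setsum_keys_plus_distrib) (simp_all add: algebra_simps single_add)

lemma pderiv_poly_single:
  "pderiv_poly s (Poly_Mapping.single m a) =
    Poly_Mapping.single (m - Poly_Mapping.single s 1) (of_nat (Poly_Mapping.lookup m s) * a)"
  by (cases "a = 0") (simp_all add: pderiv_poly_def)

lemma pderiv_poly_zero [simp]: "pderiv_poly s 0 = 0"
  by (simp add: pderiv_poly_def)

lemma pderiv_poly_sum: "pderiv_poly s (sum g A) = (\<Sum>x\<in>A. pderiv_poly s (g x))"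
  by (induction A rule: infinite_finite_induct) (simp_all add: pderiv_poly_add)

lemma poly_mapping_sum_single:
  "f = (\<Sum>m\<in>Poly_Mapping.keys f. Poly_Mapping.single m (Poly_Mapping.lookup f m))"
  by (rule poly_mapping_eqI)
    (simp add: lookup_sum lookup_single when_def in_keys_iff sum.delta)

lemma single_minus_single_add:
  fixes m k :: "'n \<Rightarrow>\<^sub>0 nat"
  assumes "Poly_Mapping.lookup m s \<noteq> 0"
  shows "(m - Poly_Mapping.single s 1) + k = m + k - Poly_Mapping.single s 1"
  using assms
  by (intro poly_mapping_eqI) (auto simp: lookup_add lookup_minus lookup_single when_def)

lemma pderiv_poly_mult_single:
  fixes m k :: "'n \<Rightarrow>\<^sub>0 nat" and a b :: real
  shows "pderiv_poly s (Poly_Mapping.single m a * Poly_Mapping.single k b) =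
    pderiv_poly s (Poly_Mapping.single m a) * Poly_Mapping.single k b +
    Poly_Mapping.single m a * pderiv_poly s (Poly_Mapping.single k b)"
proof -
  let ?e = "Poly_Mapping.single s 1"
  have 1: "Poly_Mapping.single (m - ?e + k) (of_nat (Poly_Mapping.lookup m s) * (a * b)) =
      Poly_Mapping.single (m + k - ?e) (of_nat (Poly_Mapping.lookup m s) * (a * b))"
    by (cases "Poly_Mapping.lookup m s = 0") (simp_all add: single_minus_single_add del: One_nat_def)
  have 2: "Poly_Mapping.single (m + (k - ?e)) (of_nat (Poly_Mapping.lookup k s) * (a * b)) =
      Poly_Mapping.single (m + k - ?e) (of_nat (Poly_Mapping.lookup k s) * (a * b))"
    using single_minus_single_add[of k s m]
    by (cases "Poly_Mapping.lookup k s = 0") (simp_all add: add.commute del: One_nat_def)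
  show ?thesis
    by (simp only: pderiv_poly_single mult_single lookup_add of_nat_add distrib_right single_add
        mult.assoc mult.left_commute[of a "of_nat (Poly_Mapping.lookup k s)" b] 1 2)
qed

lemma pderiv_poly_mult: "pderiv_poly s (f * g) = pderiv_poly s f * g + f * pderiv_poly s g"
proof -
  have sums: "pderiv_poly s (sum F A * sum G B) =
      pderiv_poly s (sum F A) * sum G B + sum F A * pderiv_poly s (sum G B)"
    if "\<And>x y. pderiv_poly s (F x * G y) = pderiv_poly s (F x) * G y + F x * pderiv_poly s (G y)"
    for F G :: "('a \<Rightarrow>\<^sub>0 nat) \<Rightarrow> 'a mpoly" and A B
    by (simp only: sum_product pderiv_poly_sum that sum.distrib)
  show ?thesis
    using sums[of "\<lambda>m. Poly_Mapping.single m (Poly_Mapping.lookup f m)"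
        "\<lambda>m. Poly_Mapping.single m (Poly_Mapping.lookup g m)"
        "Poly_Mapping.keys f" "Poly_Mapping.keys g", OF pderiv_poly_mult_single]
    unfolding poly_mapping_sum_single[symmetric] .
qed

text \<open>The partial derivative on the fraction field (quotient rule).\<close>

lift_definition pderiv_fract :: "'n::linorder \<Rightarrow> 'n mpoly fract \<Rightarrow> 'n mpoly fract" is
  "\<lambda>s q. (pderiv_poly s (fst q) * snd q - fst q * pderiv_poly s (snd q), snd q * snd q)"
proof -
  fix s :: 'n and q1 q2 :: "'n mpoly \<times> 'n mpoly"
  assume "fractrel q1 q2"
  then have nz: "snd q1 \<noteq> 0" "snd q2 \<noteq> 0" and eq: "fst q1 * snd q2 = fst q2 * snd q1"
    by auto
  define a b c d where "a = fst q1" and "b = snd q1" and "c = fst q2" and "d = snd q2"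
  define a' b' c' d' where "a' = pderiv_poly s a" and "b' = pderiv_poly s b"
    and "c' = pderiv_poly s c" and "d' = pderiv_poly s d"
  have e: "a * d = c * b"
    using eq by (simp add: a_def b_def c_def d_def)
  then have "pderiv_poly s (a * d) = pderiv_poly s (c * b)"
    by simp
  then have e': "a' * d + a * d' = c' * b + c * b'"
    by (simp add: pderiv_poly_mult a'_def b'_def c'_def d'_def)
  have "(a' * b - a * b') * (d * d) = (c' * d - c * d') * (b * b)"
  proof -
    have "(a' * b - a * b') * (d * d) = b * d * (a' * d) - (a * d) * (b' * d)"
      by (simp add: algebra_simps)
    also have "\<dots> = b * d * (c' * b + c * b' - a * d') - (c * b) * (b' * d)"
      using e e' by (metis add_diff_cancel_right')
    also have "\<dots> = b * b * (c' * d) - b * d' * (a * d)"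
      by (simp add: algebra_simps)
    also have "\<dots> = (c' * d - c * d') * (b * b)"
      by (simp only: e) (simp add: algebra_simps)
    finally show ?thesis .
  qed
  then show "fractrel
      (pderiv_poly s (fst q1) * snd q1 - fst q1 * pderiv_poly s (snd q1), snd q1 * snd q1)
      (pderiv_poly s (fst q2) * snd q2 - fst q2 * pderiv_poly s (snd q2), snd q2 * snd q2)"
    using nz by (simp add: a_def b_def c_def d_def a'_def b'_def c'_def d'_def)
qed


section \<open>Vector fields and multivector fields\<close>

text \<open>A polynomial vector field \<open>\<Sum>\<^sub>s V\<^sub>s \<partial>\<^sub>s\<close> is given by its components.\<close>

definition vf_apply :: "('n::finite \<Rightarrow> 'n mpoly) \<Rightarrow> 'n mpoly \<Rightarrow> 'n mpoly" where
  "vf_apply V f = (\<Sum>s\<in>UNIV. V s * pderiv_poly s f)"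

definition vf_commute :: "('n::finite \<Rightarrow> 'n mpoly) \<Rightarrow> ('n \<Rightarrow> 'n mpoly) \<Rightarrow> bool" where
  "vf_commute V W \<longleftrightarrow> (\<forall>f. vf_apply V (vf_apply W f) = vf_apply W (vf_apply V f))"

definition divergence :: "('n::finite \<Rightarrow> 'n mpoly) \<Rightarrow> 'n mpoly" where
  "divergence V = (\<Sum>s\<in>UNIV. pderiv_poly s (V s))"

text \<open>Multivector fields with rational coefficients: \<open>w I\<close> is the coefficient of
  \<open>\<partial>\<^bsub>i1\<^esub> \<and> \<dots> \<and> \<partial>\<^bsub>ip\<^esub>\<close> for \<open>I = {i1 < \<dots> < ip}\<close>.\<close>

type_synonym 'n mvf = "'n set \<Rightarrow> 'n mpoly fract"

definition mvf_scale :: "real \<Rightarrow> 'n::{finite,linorder} mvf \<Rightarrow> 'n mvf" where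
  "mvf_scale c w = (\<lambda>I. Fract (Poly_Mapping.single 0 c) 1 * w I)"

definition mvf_pderiv :: "'n::{finite,linorder} \<Rightarrow> 'n mvf \<Rightarrow> 'n mvf" where
  "mvf_pderiv s w = (\<lambda>I. pderiv_fract s (w I))"

definition mvf_of_vf :: "('n::{finite,linorder} \<Rightarrow> 'n mpoly) \<Rightarrow> 'n mvf" where
  "mvf_of_vf V I = (\<Sum>s\<in>UNIV. if I = {s} then Fract (V s) 1 else 0)"

text \<open>The Schouten-Nijenhuis bracket. With the \<open>\<partial>\<^sub>s\<close> treated as odd variables \<open>\<theta>\<^sub>s\<close>, it is
  \<open>[P, Q] = \<Sum>\<^sub>s (P \<leftarrow> \<partial>/\<partial>\<theta>\<^sub>s) \<and> (\<partial>Q/\<partial>x\<^sub>s) - (\<partial>P/\<partial>x\<^sub>s) \<and> (\<partial>/\<partial>\<theta>\<^sub>s \<rightarrow> Q)\<close>. The sign convention is the one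
  fixed by \<open>sn_bracket_vf\<close>, \<open>sn_bracket_wedge_scalar\<close> and \<open>sn_bracket_mult_right\<close> below.\<close>

definition sn_bracket :: "'n::{finite,linorder} mvf \<Rightarrow> 'n mvf \<Rightarrow> 'n mvf" where
  "sn_bracket P Q =
    (\<Sum>s\<in>UNIV. wedge (right_deriv s P) (mvf_pderiv s Q) - wedge (mvf_pderiv s P) (left_deriv s Q))"

lemma sum_fun_apply: "(\<Sum>s\<in>A. F s) x = (\<Sum>s\<in>A. F s x)" for F :: "'b \<Rightarrow> 'c \<Rightarrow> 'd::comm_monoid_add"
  by (induction A rule: infinite_finite_induct) simp_all

lemma signed_zero [simp]: "signed k 0 = 0"
  by (simp add: signed_def)

lemma signed_add: "signed k (x + y) = signed k x + signed k y"
  by (simp add: signed_def)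

lemma mult_signed: "a * signed k x = signed k (a * x)" for a :: "'a::comm_ring_1"
  by (simp add: signed_def)

lemma inversions_empty [simp]: "inversions I {} = 0"
  by (simp add: inversions_def)

lemma wedge_sum_left: "wedge (\<Sum>s\<in>A. R s) Q = (\<Sum>s\<in>A. wedge (R s) Q)"
proof -
  have "wedge (u + v) Q = wedge u Q + wedge v Q" for u v
  proof
    show "wedge (u + v) Q K = (wedge u Q + wedge v Q) K" for K
      by (simp add: wedge_def distrib_right signed_add sum.distrib)
  qed
  moreover have "wedge 0 Q = 0"
  proof
    show "wedge 0 Q K = 0 K" for K
      by (simp add: wedge_def)
  qed
  ultimately show ?thesis
    by (induction A rule: infinite_finite_induct) simp_all
qed

lemma wedge_scalar_form: "wedge w (scalar_form a) = (\<lambda>I. w I * a)"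
proof
  fix K
  have "wedge w (scalar_form a) K = (\<Sum>I\<in>Pow K. if I = K then w K * a else 0)"
    unfolding wedge_def
    by (rule sum.cong) (auto simp: scalar_form_def signed_def)
  then show "wedge w (scalar_form a) K = w K * a"
    by simp
qed

lemma pderiv_fract_Fract:
  "b \<noteq> 0 \<Longrightarrow> pderiv_fract s (Fract a b) =
    Fract (pderiv_poly s a * b - a * pderiv_poly s b) (b * b)"
  by (simp add: Fract.abs_eq pderiv_fract.abs_eq)

lemma pderiv_fract_mult: "pderiv_fract s (f * g) = pderiv_fract s f * g + f * pderiv_fract s g"
proof -
  obtain a b where f: "f = Fract a b" and b: "b \<noteq> 0"
    by (cases f)
  obtain c d where g: "g = Fract c d" and d: "d \<noteq> 0"
    by (cases g)
  define N1 N2 where "N1 = pderiv_poly s a * b - a * pderiv_poly s b"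
    and "N2 = pderiv_poly s c * d - c * pderiv_poly s d"
  have "pderiv_fract s f = Fract N1 (b * b)" "pderiv_fract s g = Fract N2 (d * d)"
    using b d by (simp_all add: f g pderiv_fract_Fract N1_def N2_def)
  then have "pderiv_fract s f * g = Fract (N1 * (c * d)) ((b * d) * (b * d))"
    "f * pderiv_fract s g = Fract (N2 * (a * b)) ((b * d) * (b * d))"
    using b d by (simp_all add: f g eq_fract ac_simps)
  moreover have "Fract x e + Fract y e = Fract (x + y) e" if "e \<noteq> 0" for x y e :: "'a mpoly"
    using that by (simp add: eq_fract distrib_right mult.assoc)
  moreover have "pderiv_fract s (f * g) =
      Fract (N1 * (c * d) + N2 * (a * b)) ((b * d) * (b * d))"
    using b d
    by (simp add: f g pderiv_fract_Fract pderiv_poly_mult N1_def N2_def)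
      (rule arg_cong2[where f = Fract], simp_all add: algebra_simps)
  ultimately show ?thesis
    using b d by simp
qed

lemma pderiv_fract_zero [simp]: "pderiv_fract s 0 = 0"
  using pderiv_fract_Fract[of 1 s 0] by (simp add: Zero_fract_def eq_fract)

lemma sn_bracket_scalar_form:
  fixes P :: "'n::{finite,linorder} mvf"
  shows "sn_bracket P (scalar_form g) = (\<Sum>s\<in>UNIV. (\<lambda>I. right_deriv s P I * pderiv_fract s g))"
proof -
  have "mvf_pderiv s (scalar_form g) = scalar_form (pderiv_fract s g)" for s :: 'n
    by (auto simp: mvf_pderiv_def scalar_form_def)
  moreover have "left_deriv s (scalar_form g) = (\<lambda>I. 0)" for s :: 'n
    by (auto simp: left_deriv_def scalar_form_def)
  moreover have "wedge w (\<lambda>I. 0) = 0" for w :: "'n mvf"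
    by (auto simp: wedge_def zero_fun_def)
  ultimately show ?thesis
    by (simp add: sn_bracket_def wedge_scalar_form)
qed

lemma sn_bracket_mult_right:
  "sn_bracket P (\<lambda>I. g * Q I) =
    wedge (sn_bracket P (scalar_form g)) Q + (\<lambda>I. g * sn_bracket P Q I)"
proof
  fix K
  have 1: "wedge (right_deriv s P) (mvf_pderiv s (\<lambda>I. g * Q I)) K =
      wedge (\<lambda>I. right_deriv s P I * pderiv_fract s g) Q K +
      g * wedge (right_deriv s P) (mvf_pderiv s Q) K" for s
    unfolding wedge_def mvf_pderiv_def sum_distrib_left sum.distrib[symmetric] pderiv_fract_mult
      mult_signed signed_add[symmetric]
    by (rule sum.cong) (simp_all add: distrib_left ac_simps)
  have 2: "wedge R (left_deriv s (\<lambda>I. g * Q I)) K = g * wedge R (left_deriv s Q) K" for R s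
    unfolding wedge_def sum_distrib_left mult_signed
    by (rule sum.cong) (auto simp: left_deriv_def mult_signed[symmetric] ac_simps)
  show "sn_bracket P (\<lambda>I. g * Q I) K =
      (wedge (sn_bracket P (scalar_form g)) Q + (\<lambda>I. g * sn_bracket P Q I)) K"
    unfolding sn_bracket_scalar_form wedge_sum_left
    by (simp add: sn_bracket_def sum_fun_apply 1 2 sum_distrib_left right_diff_distrib
        sum.distrib sum_subtractf)
qed

lemma mvf_of_vf_eq_0: "(\<And>s. I \<noteq> {s}) \<Longrightarrow> mvf_of_vf V I = 0"
  by (simp add: mvf_of_vf_def)

lemma mvf_of_vf_singleton [simp]: "mvf_of_vf V {s} = Fract (V s) 1"
  by (simp add: mvf_of_vf_def)

lemma right_deriv_wedge_vf:
  "right_deriv s (wedge (mvf_of_vf V) (mvf_of_vf W)) I =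
    mvf_of_vf V I * Fract (W s) 1 - Fract (V s) 1 * mvf_of_vf W I"
proof (cases "\<exists>t. I = {t}")
  case True
  then obtain t where I: "I = {t}"
    by blast
  show ?thesis
  proof (cases "s = t")
    case True
    then show ?thesis
      by (simp add: I right_deriv_def)
  next
    case False
    have sep: "{s} \<noteq> {t}" "{s, t} - {s} = {t}" "{s, t} - {t} = {s}" "{s, t} \<noteq> {s}" "{s, t} \<noteq> {t}"
      using False by auto
    have Pow: "Pow {s, t} = {{}, {s}, {t}, {s, t}}"
      by auto
    have empty: "mvf_of_vf U {} = 0" for U :: "'a \<Rightarrow> 'a mpoly"
      by (rule mvf_of_vf_eq_0) simp
    have inv: "inversions {a} {b} = (if b < a then 1 else 0)" for a b :: 'a
    proof -
      have "{(i, j). i \<in> {a} \<and> j \<in> {b} \<and> j < i} = (if b < a then {(a, b)} else {})"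
        by auto
      then show ?thesis
        by (simp add: inversions_def)
    qed
    have "wedge (mvf_of_vf V) (mvf_of_vf W) {s, t} =
        signed (inversions {s} {t}) (Fract (V s) 1 * Fract (W t) 1) +
        signed (inversions {t} {s}) (Fract (V t) 1 * Fract (W s) 1)"
      unfolding wedge_def Pow using sep by (simp add: empty del: mult_fract)
    then show ?thesis
      using False by (auto simp: I right_deriv_def inv signed_def simp del: mult_fract)
  qed
next
  case False
  have "wedge (mvf_of_vf V) (mvf_of_vf W) (insert s I) = 0" if "s \<notin> I"
    unfolding wedge_def
  proof (rule sum.neutral, rule ballI)
    fix J
    assume J: "J \<in> Pow (insert s I)"
    have "\<not> ((\<exists>a. J = {a}) \<and> (\<exists>b. insert s I - J = {b}))"
    proof
      assume "(\<exists>a. J = {a}) \<and> (\<exists>b. insert s I - J = {b})"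
      then obtain a b where "J = {a}" "insert s I - J = {b}"
        by blast
      then have "insert s I = {a, b}" "a \<noteq> b"
        using J by auto
      then have "I = {a, b} - {s}" "s = a \<or> s = b"
        using that by auto
      then have "I = {a} \<or> I = {b}"
        using \<open>a \<noteq> b\<close> by auto
      then show False
        using False by blast
    qed
    then have "mvf_of_vf V J = 0 \<or> mvf_of_vf W (insert s I - J) = 0"
      using mvf_of_vf_eq_0 by metis
    then show "signed (inversions J (insert s I - J))
        (mvf_of_vf V J * mvf_of_vf W (insert s I - J)) = 0"
      by auto
  qed
  moreover have "mvf_of_vf V I = 0" "mvf_of_vf W I = 0"
    using False by (auto intro: mvf_of_vf_eq_0)
  ultimately show ?thesis
    by (simp add: right_deriv_def)
qed

lemma Fract_sum_1: "Fract (sum g A) 1 = (\<Sum>x\<in>A. Fract (g x) 1)"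
proof (induction A rule: infinite_finite_induct)
  case (insert x A)
  then show ?case
    using add_fract[of 1 1 "g x" "sum g A"] by simp
qed (simp_all add: Zero_fract_def)

lemma pderiv_fract_Fract_1: "pderiv_fract s (Fract f 1) = Fract (pderiv_poly s f) 1"
proof -
  have "pderiv_poly s 1 = 0"
    using pderiv_poly_single[of s 0 1] by simp
  then show ?thesis
    by (simp add: pderiv_fract_Fract)
qed

lemma scalar_form_wedge: "wedge (scalar_form a) w = (\<lambda>I. a * w I)"
proof
  fix K
  have "inversions {} J = 0" for J :: "'a set"
    by (simp add: inversions_def)
  then have "wedge (scalar_form a) w K = (\<Sum>I\<in>Pow K. if I = {} then a * w K else 0)"
    unfolding wedge_def
    by (intro sum.cong) (auto simp: scalar_form_def signed_def)
  then show "wedge (scalar_form a) w K = a * w K"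
    by simp
qed

lemma sn_bracket_vf:
  "sn_bracket (mvf_of_vf V) (mvf_of_vf W) =
    mvf_of_vf (\<lambda>t. vf_apply V (W t) - vf_apply W (V t))"
proof
  fix I
  have ins: "I = {}" if "insert s I = {t}" "s \<notin> I" for s t and I :: "'a set"
    using that by auto
  have "mvf_of_vf U (insert s I) = (if I = {} then Fract (U s) 1 else 0)" if "s \<notin> I"
    for s I and U :: "'a \<Rightarrow> 'a mpoly"
    using that by (auto intro!: mvf_of_vf_eq_0 dest: ins)
  then have "right_deriv s (mvf_of_vf U) = scalar_form (Fract (U s) 1)"
    "left_deriv s (mvf_of_vf U) = scalar_form (Fract (U s) 1)" for s and U :: "'a \<Rightarrow> 'a mpoly"
    by (auto simp: fun_eq_iff right_deriv_def left_deriv_def scalar_form_def signed_def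
        inversions_def)
  then have *: "sn_bracket (mvf_of_vf V) (mvf_of_vf W) I =
      (\<Sum>s\<in>UNIV. Fract (V s) 1 * pderiv_fract s (mvf_of_vf W I)) -
      (\<Sum>s\<in>UNIV. Fract (W s) 1 * pderiv_fract s (mvf_of_vf V I))"
    by (simp add: sn_bracket_def wedge_scalar_form scalar_form_wedge sum_fun_apply sum_subtractf
        mvf_pderiv_def mult.commute del: mult_fract)
  have Lie: "Fract (vf_apply V (W t) - vf_apply W (V t)) 1 =
      (\<Sum>s\<in>UNIV. Fract (V s) 1 * pderiv_fract s (Fract (W t) 1)) -
      (\<Sum>s\<in>UNIV. Fract (W s) 1 * pderiv_fract s (Fract (V t) 1))" for t
    using diff_fract[of 1 1 "vf_apply V (W t)" "vf_apply W (V t)"]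
    by (simp add: vf_apply_def Fract_sum_1 pderiv_fract_Fract_1)
  show "sn_bracket (mvf_of_vf V) (mvf_of_vf W) I =
      mvf_of_vf (\<lambda>t. vf_apply V (W t) - vf_apply W (V t)) I"
  proof (cases "\<exists>t. I = {t}")
    case True
    then obtain t where I: "I = {t}"
      by blast
    show ?thesis
      unfolding * unfolding I mvf_of_vf_singleton Lie ..
  next
    case False
    then have "mvf_of_vf U I = 0" for U :: "'a \<Rightarrow> 'a mpoly"
      by (auto intro: mvf_of_vf_eq_0)
    then show ?thesis
      unfolding * by simp
  qed
qed

lemma sn_bracket_wedge_scalar:
  "sn_bracket (wedge (mvf_of_vf V) (mvf_of_vf W)) (scalar_form (Fract f 1)) =
    (\<lambda>I. Fract (vf_apply W f) 1 * mvf_of_vf V I - Fract (vf_apply V f) 1 * mvf_of_vf W I)"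
proof
  fix I
  have vf: "Fract (vf_apply U f) 1 = (\<Sum>s\<in>UNIV. Fract (U s) 1 * pderiv_fract s (Fract f 1))"
    for U :: "'a \<Rightarrow> 'a mpoly"
    by (simp add: vf_apply_def Fract_sum_1 pderiv_fract_Fract_1)
  show "sn_bracket (wedge (mvf_of_vf V) (mvf_of_vf W)) (scalar_form (Fract f 1)) I =
      Fract (vf_apply W f) 1 * mvf_of_vf V I - Fract (vf_apply V f) 1 * mvf_of_vf W I"
    unfolding sn_bracket_scalar_form sum_fun_apply right_deriv_wedge_vf
    unfolding vf sum_distrib_right sum_subtractf[symmetric]
    by (rule sum.cong) (simp_all only: right_diff_distrib left_diff_distrib ac_simps)
qed

section \<open>Potential cochains and Lichnerowicz-Poisson cohomology\<close>

type_synonym 'n poly_matrix = "(('n mpoly, 'n) vec, 'n) vec"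

text \<open>The rows of \<open>l\<close> are the components of the vector fields \<open>Y\<^sub>i = \<Sum>\<^sub>s l\<^sub>i\<^sub>s \<partial>\<^sub>s\<close>.\<close>

definition Yf :: "'n::finite poly_matrix \<Rightarrow> 'n \<Rightarrow> 'n \<Rightarrow> 'n mpoly" where
  "Yf l i s = l $ i $ s"

definition Xf :: "'n::finite poly_matrix \<Rightarrow> ('n \<Rightarrow> 'n \<Rightarrow> real) \<Rightarrow> 'n \<Rightarrow> 'n \<Rightarrow> 'n mpoly" where
  "Xf l \<alpha> i s = (\<Sum>j\<in>UNIV - {i}. poly_scale (\<alpha> i j) (Yf l j s))"

text \<open>\<open>X\<^sub>i - \<delta>\<^sub>i id\<close>. As \<open>X\<^sub>i\<close> is linear, \<open>\<delta>\<^sub>i = div X\<^sub>i\<close> is a constant polynomial.\<close>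

definition X_delta ::
    "'n::finite poly_matrix \<Rightarrow> ('n \<Rightarrow> 'n \<Rightarrow> real) \<Rightarrow> 'n \<Rightarrow> 'n mpoly \<Rightarrow> 'n mpoly" where
  "X_delta l \<alpha> i f = vf_apply (Xf l \<alpha> i) f - divergence (Xf l \<alpha> i) * f"

text \<open>\<open>Y\<^bsub>i1\<^esub> \<and> \<dots> \<and> Y\<^bsub>ip\<^esub>\<close> for \<open>I = {i1 < \<dots> < ip}\<close>.\<close>

definition Y_wedge :: "'n::{finite,linorder} poly_matrix \<Rightarrow> 'n set \<Rightarrow> 'n mvf" where
  "Y_wedge l I =
    foldr (\<lambda>i. wedge (mvf_of_vf (Yf l i))) (sorted_list_of_set I) (scalar_form 1)"

definition Poisson_tensor ::
    "'n::{finite,linorder} poly_matrix \<Rightarrow> ('n \<Rightarrow> 'n \<Rightarrow> real) \<Rightarrow> 'n mvf" where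
  "Poisson_tensor l \<alpha> =
    (\<Sum>(i, j)\<in>{(i, j). i < j}.
      mvf_scale (\<alpha> i j) (wedge (mvf_of_vf (Yf l i)) (mvf_of_vf (Yf l j))))"

text \<open>\<open>potential_cochains l r p\<close> is \<open>\<P>\<^sup>p\<^sup>r = D\<^sup>-\<^sup>1 \<S>\<^sup>r \<real>\<^sup>n\<^sup>* \<otimes> \<And>\<^sup>p\<langle>Y\<^sub>1, \<dots>, Y\<^sub>n\<rangle>\<close> with \<open>D = det l\<close>,
  as a space of multivector fields. Being homogeneous of degree \<open>r\<close>, the numerators are
  polynomials, so rational coefficients suffice and no formal power series occur.\<close>

definition potential_cochains ::
    "'n::{finite,linorder} poly_matrix \<Rightarrow> nat \<Rightarrow> nat \<Rightarrow> 'n mvf set" where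
  "potential_cochains l r p =
    {\<Sum>I | card I = p. (\<lambda>K. Fract (f I) (det l) * Y_wedge l I K) | f. \<forall>I. f I \<in> hom_polys r}"

definition LH ::
    "'n::{finite,linorder} poly_matrix \<Rightarrow> 'n mvf \<Rightarrow> nat
      \<Rightarrow> (real, nat \<Rightarrow> 'n mvf set) vspace" where
  "LH l \<Lambda> r =
    direct_sum {..CARD('n)} (cohomology mvf_scale (potential_cochains l r) (sn_bracket \<Lambda>))"

end

theory Submission
  imports Defs
begin

text \<open>Write \<open>L\<^sub>V\<close> for the Lie derivative. Since \<open>[V \<and> W, Q] = V \<and> L\<^sub>W Q - W \<and> L\<^sub>V Q\<close> and the commuting
  fields \<open>Y\<^sub>j\<close> annihilate every \<open>Y\<^sub>I\<close>, one gets \<open>[\<Lambda>, g Y\<^sub>I] = \<Sum>\<^sub>k X\<^sub>k(g) Y\<^sub>k \<and> Y\<^sub>I\<close>. Commutation also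
  gives \<open>Y\<^sub>k(D) = div(Y\<^sub>k) D\<close>, hence \<open>X\<^sub>k(f / D) = (X\<^sub>k f - \<delta>\<^sub>k f) / D\<close>. So \<open>f \<otimes> \<eta>\<^sub>I \<mapsto> (f / D) Y\<^sub>I\<close>
  intertwines the Koszul differential with \<open>[\<Lambda>, \<cdot>]\<close>; it is injective because \<open>D \<noteq> 0\<close> makes the
  \<open>Y\<^sub>i\<close> a frame over the rational functions.\<close>

section \<open>Multiplication by vectors in a Grassmann algebra\<close>

text \<open>The bracket is defined in the coordinate generators, while the cochains live in the
  frame Y. To control the signs of this change of generators, no general product is manipulated: a
  bivector V \<and> W and each Y_I are iterated left multiplications applied to 1, so the calculus
  rests on \<open>vec_mult\<close>, its anticommutation, and the canonical relation between
  \<open>gen_mult\<close> and \<open>left_deriv\<close>. Associativity of \<open>wedge\<close> is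
  then needed only when the first factor is a vector.

  The identity for Y_k(D) is Liouville's formula. Commutation says that Y_k differentiates each
  column of the matrix l by the Jacobian matrix of Y_k, and the logarithmic derivative of the
  determinant of such a system is the trace of its matrix, here the divergence.

  Injectivity comes from functoriality of the exterior algebra: the inverse matrix over the rational
  functions induces a left inverse, so no minors need to be computed. As the map is then an
  isomorphism of complexes, its passage to cohomology only concerns cosets.\<close>

lemma inversions_singleton: "inversions {k} I = card {j \<in> I. j < k}"
proof -
  have "{(i, j). i \<in> {k} \<and> j \<in> I \<and> j < i} = Pair k ` {j \<in> I. j < k}"
    by auto
  then show ?thesis
    by (simp add: inversions_def card_image inj_on_def)
qed

lemma inversions_singleton_insert:
  fixes I :: "'n::{finite,linorder} set"
  assumes "j \<notin> I"
  shows "inversions {k} (insert j I) = inversions {k} I + (if j < k then 1 else 0)"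
proof -
  have "{x \<in> insert j I. x < k} = (if j < k then insert j {x \<in> I. x < k} else {x \<in> I. x < k})"
    by auto
  then show ?thesis
    using assms by (simp add: inversions_singleton)
qed

lemma inversions_union_left:
  fixes I J K :: "'n::{finite,linorder} set"
  assumes "I \<inter> J = {}"
  shows "inversions (I \<union> J) K = inversions I K + inversions J K"
proof -
  have "{(i, j). i \<in> I \<union> J \<and> j \<in> K \<and> j < i} =
      {(i, j). i \<in> I \<and> j \<in> K \<and> j < i} \<union> {(i, j). i \<in> J \<and> j \<in> K \<and> j < i}"
    by auto
  then show ?thesis
    using assms unfolding inversions_def by (subst card_Un_disjoint[symmetric]) auto
qed

lemma inversions_union_right:
  fixes I J K :: "'n::{finite,linorder} set"
  assumes "J \<inter> K = {}"
  shows "inversions I (J \<union> K) = inversions I J + inversions I K"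
proof -
  have "{(i, j). i \<in> I \<and> j \<in> J \<union> K \<and> j < i} =
      {(i, j). i \<in> I \<and> j \<in> J \<and> j < i} \<union> {(i, j). i \<in> I \<and> j \<in> K \<and> j < i}"
    by auto
  then show ?thesis
    using assms unfolding inversions_def by (subst card_Un_disjoint[symmetric]) auto
qed

lemma signed_sum: "signed k (sum f A) = (\<Sum>x\<in>A. signed k (f x))"
  by (simp add: signed_def sum_negf)

lemma signed_signed: "signed j (signed k x) = signed (j + k) x"
  by (auto simp: signed_def)

lemma signed_Suc: "signed (Suc k) x = - signed k x"
  by (simp add: signed_def)

lemma gen_mult_add: "gen_mult k (u + v) = gen_mult k u + gen_mult k v"
  by (auto simp: gen_mult_def signed_add fun_eq_iff)

lemma gen_mult_sum: "gen_mult k (\<Sum>x\<in>A. f x) = (\<Sum>x\<in>A. gen_mult k (f x))"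
  by (rule additive.sum[of "gen_mult k", OF additive.intro]) (rule gen_mult_add)

lemma gen_mult_scale:
  "gen_mult k (\<lambda>I. a * w I) K = a * gen_mult k w K" for a :: "'a::comm_ring_1"
  by (simp add: gen_mult_def mult_signed)

lemma left_deriv_scale:
  "left_deriv k (\<lambda>I. a * w I) K = a * left_deriv k w K" for a :: "'a::comm_ring_1"
  by (simp add: left_deriv_def mult_signed)

lemma left_deriv_add: "left_deriv k (u + v) = left_deriv k u + left_deriv k v"
  by (auto simp: left_deriv_def signed_add fun_eq_iff)

lemma left_deriv_sum: "left_deriv k (\<Sum>x\<in>A. f x) = (\<Sum>x\<in>A. left_deriv k (f x))"
  by (rule additive.sum[of "left_deriv k", OF additive.intro]) (rule left_deriv_add)

text \<open>With M the set K without s and t, the two orders produce the same inversions with M; the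
  pair s, t itself contributes one inversion in exactly one of the two orders.\<close>

lemma gen_mult_gen_mult: "gen_mult s (gen_mult t w) K = - gen_mult t (gen_mult s w) K"
proof (cases "s \<noteq> t \<and> s \<in> K \<and> t \<in> K")
  case True
  define M where "M = K - {s} - {t}"
  have eqs: "K - {s} = insert t M" "K - {t} = insert s M" "insert t M - {t} = M"
      "insert s M - {s} = M" "s \<notin> M" "t \<notin> M"
    using True by (auto simp: M_def)
  have "s < t \<or> t < s" using True by auto
  then show ?thesis
    using True eqs
    by (auto simp: gen_mult_def eqs inversions_singleton_insert signed_def)
qed (auto simp: gen_mult_def)

lemma gen_mult_same: "gen_mult s (gen_mult s w) K = 0"
  by (simp add: gen_mult_def)

text \<open>This is the canonical anticommutation relation between creation and annihilation
  operators; it makes \<open>left_deriv\<close> an odd derivation.\<close>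

lemma left_deriv_gen_mult:
  "left_deriv s (gen_mult t w) K = (if s = t then w K else 0) - gen_mult t (left_deriv s w) K"
proof (cases "s = t")
  case True
  then show ?thesis
    by (cases "t \<in> K")
      (auto simp: gen_mult_def left_deriv_def signed_signed insert_absorb signed_def)
next
  case False
  show ?thesis
  proof (cases "s \<notin> K \<and> t \<in> K")
    case True
    then obtain M where K: "K = insert t M" and M: "t \<notin> M" "s \<notin> M"
      by (metis Set.set_insert insertCI)
    have diff: "insert s (insert t M) - {t} = insert s M" "insert t M - {t} = M"
      using M False by auto
    have inv: "inversions {s} (insert t M) = inversions {s} M + (if t < s then 1 else 0)"
      "inversions {t} (insert s M) = inversions {t} M + (if s < t then 1 else 0)"
      using M by (simp_all add: inversions_singleton_insert)
    have "left_deriv s (gen_mult t w) K =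
        signed (inversions {s} (insert t M)) (signed (inversions {t} (insert s M)) (w (insert s M)))"
      using M False by (simp only: left_deriv_def gen_mult_def K diff insert_iff) simp
    moreover have "gen_mult t (left_deriv s w) K =
        signed (inversions {t} M) (signed (inversions {s} M) (w (insert s M)))"
      using M False by (simp only: left_deriv_def gen_mult_def K diff insert_iff) simp
    ultimately show ?thesis
      using False unfolding inv by (cases s t rule: linorder_cases) (auto simp: signed_def dest: less_asym)
  qed (use False in \<open>auto simp: gen_mult_def left_deriv_def\<close>)
qed

text \<open>Only the subsets I = insert k J of K contribute on the left. With L the rest of K,
  additivity of inversions gives both sides the exponent inv(k,J) + inv(k,L) + inv(J,L).\<close>

lemma wedge_gen_mult: "wedge (gen_mult k u) w = gen_mult k (wedge u w)"
proof
  fix K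
  show "wedge (gen_mult k u) w K = gen_mult k (wedge u w) K"
  proof (cases "k \<in> K")
    case False
    then show ?thesis
      by (auto simp: wedge_def gen_mult_def intro!: sum.neutral)
  next
    case True
    have "wedge (gen_mult k u) w K =
        (\<Sum>I\<in>insert k ` Pow (K - {k}). signed (inversions I (K - I)) (gen_mult k u I * w (K - I)))"
      unfolding wedge_def
    proof (rule sum.mono_neutral_right)
      show "\<forall>I\<in>Pow K - insert k ` Pow (K - {k}).
          signed (inversions I (K - I)) (gen_mult k u I * w (K - I)) = 0"
      proof
        fix I assume I: "I \<in> Pow K - insert k ` Pow (K - {k})"
        have "k \<notin> I"
        proof
          assume "k \<in> I"
          then have "I = insert k (I - {k})" "I - {k} \<in> Pow (K - {k})" using I by auto
          then show False using I by blast
        qed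
        then show "signed (inversions I (K - I)) (gen_mult k u I * w (K - I)) = 0"
          by (simp add: gen_mult_def)
      qed
    qed (use True in auto)
    also have "\<dots> = (\<Sum>J\<in>Pow (K - {k}). signed (inversions (insert k J) (K - insert k J))
        (gen_mult k u (insert k J) * w (K - insert k J)))"
      by (rule sum.reindex_cong[where l = "insert k"]) (auto simp: inj_on_def)
    also have "\<dots> = (\<Sum>J\<in>Pow (K - {k}). signed (inversions {k} (K - {k}))
        (signed (inversions J (K - {k} - J)) (u J * w (K - {k} - J))))"
    proof (rule sum.cong[OF refl])
      fix J assume "J \<in> Pow (K - {k})"
      then have k: "k \<notin> J" and J: "K - {k} = J \<union> (K - {k} - J)" by auto
      define L where "L = K - {k} - J"
      have L: "K - insert k J = L" by (auto simp: L_def)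
      have "K - {k} = J \<union> L" "J \<inter> L = {}" using J by (auto simp: L_def)
      then have "inversions {k} (K - {k}) = inversions {k} J + inversions {k} L"
        by (simp add: inversions_union_right)
      moreover have "inversions (insert k J) L = inversions {k} L + inversions J L"
        using inversions_union_left[of "{k}" J L] k by simp
      ultimately show "signed (inversions (insert k J) (K - insert k J))
          (gen_mult k u (insert k J) * w (K - insert k J)) =
        signed (inversions {k} (K - {k})) (signed (inversions J (K - {k} - J)) (u J * w (K - {k} - J)))"
        using k by (simp add: L flip: L_def) (auto simp: gen_mult_def signed_def)
    qed
    also have "\<dots> = gen_mult k (wedge u w) K"
      using True by (simp add: gen_mult_def wedge_def signed_sum)
    finally show ?thesis .
  qed
qed

text \<open>Left exterior multiplication by a vector, built from \<open>gen_mult\<close> so that the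
  relations between generators extend by bilinearity.\<close>

definition vec_mult :: "('n::{finite,linorder} \<Rightarrow> 'a::comm_ring_1) \<Rightarrow> ('n set \<Rightarrow> 'a) \<Rightarrow> 'n set \<Rightarrow> 'a"
  where "vec_mult v w K = (\<Sum>s\<in>UNIV. v s * gen_mult s w K)"

lemma vec_mult_eq_sum: "vec_mult v w = (\<Sum>s\<in>UNIV. (\<lambda>K. v s * gen_mult s w K))"
  by (simp add: fun_eq_iff vec_mult_def sum_fun_apply)

lemma vec_mult_add: "vec_mult v (u + w) = vec_mult v u + vec_mult v w"
  by (simp add: fun_eq_iff vec_mult_def gen_mult_add distrib_left sum.distrib)

lemma vec_mult_zero [simp]: "vec_mult v 0 = 0"
  by (rule additive.zero[of "vec_mult v", OF additive.intro]) (rule vec_mult_add)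

lemma vec_mult_sum: "vec_mult v (\<Sum>x\<in>A. f x) = (\<Sum>x\<in>A. vec_mult v (f x))"
  by (rule additive.sum[of "vec_mult v", OF additive.intro]) (rule vec_mult_add)

lemma vec_mult_scale: "vec_mult v (\<lambda>I. a * w I) = (\<lambda>I. a * vec_mult v w I)"
  by (simp add: fun_eq_iff vec_mult_def gen_mult_scale sum_distrib_left ac_simps)

lemma vec_mult_uminus: "vec_mult v (- w) = - vec_mult v w"
  using vec_mult_scale[of v "-1" w] by (simp add: fun_eq_iff fun_Compl_def)

lemma vec_mult_diff: "vec_mult v (u - w) = vec_mult v u - vec_mult v w"
  using vec_mult_add[of v u "- w"] by (simp add: vec_mult_uminus)

lemma vec_mult_signed:
  "vec_mult v (\<lambda>I. signed k (w I)) = (\<lambda>I. signed k (vec_mult v w I))"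
  using vec_mult_uminus[of v w] by (cases "even k") (simp_all add: signed_def fun_Compl_def)

lemma vec_mult_vec_mult:
  "vec_mult u (vec_mult v w) K = (\<Sum>s\<in>UNIV. \<Sum>t\<in>UNIV. u s * v t * gen_mult s (gen_mult t w) K)"
  unfolding vec_mult_eq_sum[of v] vec_mult_def[of u] gen_mult_sum sum_fun_apply
  by (simp add: sum_distrib_left gen_mult_scale mult.assoc)

lemma vec_mult_anticommute: "vec_mult u (vec_mult v w) = - vec_mult v (vec_mult u w)"
proof
  fix K
  have "vec_mult u (vec_mult v w) K =
      (\<Sum>t\<in>UNIV. \<Sum>s\<in>UNIV. u s * v t * gen_mult s (gen_mult t w) K)"
    unfolding vec_mult_vec_mult by (rule sum.swap)
  also have "\<dots> = (\<Sum>t\<in>UNIV. \<Sum>s\<in>UNIV. - (v t * u s * gen_mult t (gen_mult s w) K))"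
    by (subst gen_mult_gen_mult) (simp add: ac_simps)
  finally show "vec_mult u (vec_mult v w) K = (- vec_mult v (vec_mult u w)) K"
    by (simp add: vec_mult_vec_mult sum_negf)
qed

text \<open>Anticommutation alone gives x = - x, which does not force x = 0 in an arbitrary
  commutative ring. Hence the double sum is split: the diagonal terms vanish and those with s < t
  cancel those with t < s.\<close>

lemma vec_mult_same: "vec_mult v (vec_mult v w) = 0"
proof
  fix K
  define f where "f = (\<lambda>s t. v s * v t * gen_mult s (gen_mult t w) K)"
  have skew: "f s t = - f t s" for s t
    unfolding f_def by (subst gen_mult_gen_mult) (simp add: ac_simps)
  have split: "f s t = (if s < t then f s t else 0) + (if t < s then f s t else 0)" for s t
    by (cases s t rule: linorder_cases) (auto simp: f_def gen_mult_same dest: less_asym)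
  have neg: "(if t < s then f s t else 0) = - (if t < s then f t s else 0)" for s t
    using skew[of s t] by simp
  have "(\<Sum>s\<in>UNIV. \<Sum>t\<in>UNIV. f s t) = (\<Sum>s\<in>UNIV. \<Sum>t\<in>UNIV. if s < t then f s t else 0)
      + (\<Sum>s\<in>UNIV. \<Sum>t\<in>UNIV. if t < s then f s t else 0)"
    by (subst split) (simp only: sum.distrib)
  also have "(\<Sum>s\<in>UNIV. \<Sum>t\<in>UNIV. if t < s then f s t else 0) =
      (\<Sum>t\<in>UNIV. \<Sum>s\<in>UNIV. - (if t < s then f t s else 0))"
    unfolding neg by (rule sum.swap)
  finally show "vec_mult v (vec_mult v w) K = 0 K"
    by (simp add: vec_mult_vec_mult f_def sum_negf)
qed

lemma left_deriv_vec_mult: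
  "left_deriv s (vec_mult v w) K = v s * w K - vec_mult v (left_deriv s w) K"
proof -
  have "left_deriv s (vec_mult v w) K = (\<Sum>t\<in>UNIV. v t * left_deriv s (gen_mult t w) K)"
    unfolding vec_mult_eq_sum left_deriv_sum sum_fun_apply by (simp add: left_deriv_scale)
  also have "\<dots> = (\<Sum>t\<in>UNIV. (if s = t then v t * w K else 0) - v t * gen_mult t (left_deriv s w) K)"
    by (rule sum.cong) (simp_all add: left_deriv_gen_mult right_diff_distrib)
  finally show ?thesis
    by (simp add: sum_subtractf vec_mult_def)
qed

lemma wedge_scale_left: "wedge (\<lambda>I. a * u I) w = (\<lambda>K. a * wedge u w K)"
  by (simp add: fun_eq_iff wedge_def sum_distrib_left mult_signed mult.assoc)

lemma wedge_vec_mult: "wedge (vec_mult v u) w = vec_mult v (wedge u w)"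
  unfolding vec_mult_eq_sum[of v u] wedge_sum_left
  by (simp add: fun_eq_iff sum_fun_apply wedge_scale_left wedge_gen_mult vec_mult_def)

section \<open>The exterior algebra of a frame\<close>

text \<open>The coefficient at K is the minor of m with rows I and columns K, and 0 if the
  cardinalities differ.\<close>

definition frame_wedge :: "('n::{finite,linorder} \<Rightarrow> 'n \<Rightarrow> 'a::comm_ring_1) \<Rightarrow> 'n set \<Rightarrow> 'n set \<Rightarrow> 'a"
  where "frame_wedge m I = foldr (\<lambda>i. vec_mult (m i)) (sorted_list_of_set I) (scalar_form 1)"

text \<open>The homomorphism of exterior algebras that sends the i-th generator to row i of
  m.\<close>

definition frame_map ::
    "('n::{finite,linorder} \<Rightarrow> 'n \<Rightarrow> 'a::comm_ring_1) \<Rightarrow> ('n set \<Rightarrow> 'a) \<Rightarrow> 'n set \<Rightarrow> 'a"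
  where "frame_map m w = (\<Sum>I\<in>UNIV. (\<lambda>K. w I * frame_wedge m I K))"

text \<open>The new factor moves right to its sorted place. Each smaller factor that it passes costs
  one sign and is one inversion; meeting an equal factor gives 0.\<close>

lemma vec_mult_foldr_insort:
  fixes m :: "'n::{finite,linorder} \<Rightarrow> 'n \<Rightarrow> 'a::comm_ring_1"
  assumes "sorted xs" "distinct xs"
  shows "vec_mult (m k) (foldr (\<lambda>i. vec_mult (m i)) xs u) =
    (if k \<in> set xs then 0 else
      (\<lambda>K. signed (inversions {k} (set xs)) (foldr (\<lambda>i. vec_mult (m i)) (insort k xs) u K)))"
  using assms
proof (induction xs)
  case Nil
  then show ?case by (simp add: signed_def)
next
  case (Cons x xs)
  let ?F = "\<lambda>xs. foldr (\<lambda>i. vec_mult (m i)) xs u"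
  consider "k = x" | "k < x" | "x < k" by fastforce
  then show ?case
  proof cases
    case 1
    then show ?thesis by (simp add: vec_mult_same)
  next
    case 2
    then have "inversions {k} (set (x # xs)) = 0" "k \<notin> set (x # xs)"
      using Cons.prems by (auto simp: inversions_singleton card_eq_0_iff)
    then show ?thesis using 2 by (simp add: signed_def less_imp_le)
  next
    case 3
    have x: "x \<notin> set xs" using Cons.prems by simp
    then have inv: "inversions {k} (set (x # xs)) = Suc (inversions {k} (set xs))"
      using inversions_singleton_insert[OF x] 3 by simp
    have "vec_mult (m k) (?F (x # xs)) = - vec_mult (m x) (vec_mult (m k) (?F xs))"
      by (simp add: vec_mult_anticommute[of "m k"])
    also have "\<dots> = (if k \<in> set xs then 0 else
        (\<lambda>K. signed (inversions {k} (set (x # xs))) (vec_mult (m x) (?F (insort k xs)) K)))"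
    proof (cases "k \<in> set xs")
      case True
      then show ?thesis using Cons by (simp flip: zero_fun_def)
    next
      case False
      then show ?thesis
        using Cons unfolding inv by (simp add: vec_mult_signed signed_Suc fun_Compl_def)
    qed
    finally show ?thesis using 3 by auto
  qed
qed

lemma vec_mult_frame_wedge:
  "vec_mult (m k) (frame_wedge m I) =
    (if k \<in> I then 0 else (\<lambda>K. signed (inversions {k} I) (frame_wedge m (insert k I) K)))"
  using vec_mult_foldr_insort[of "sorted_list_of_set I" m k "scalar_form 1"]
  by (simp add: frame_wedge_def)

lemma frame_map_add: "frame_map m (u + v) = frame_map m u + frame_map m v"
  by (simp add: frame_map_def fun_eq_iff sum_fun_apply distrib_right sum.distrib)

lemma frame_map_sum: "frame_map m (\<Sum>x\<in>A. f x) = (\<Sum>x\<in>A. frame_map m (f x))"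
  by (rule additive.sum[of "frame_map m", OF additive.intro]) (rule frame_map_add)

lemma frame_map_scale: "frame_map m (\<lambda>I. a * w I) = (\<lambda>K. a * frame_map m w K)"
  by (simp add: frame_map_def fun_eq_iff sum_fun_apply sum_distrib_left mult.assoc)

text \<open>Multiplicativity of the induced homomorphism, in the only form needed: left
  multiplication by one generator.\<close>

lemma frame_map_gen_mult: "frame_map m (gen_mult k w) = vec_mult (m k) (frame_map m w)"
proof
  fix K
  have "frame_map m (gen_mult k w) K =
      (\<Sum>I | k \<in> I. signed (inversions {k} (I - {k})) (w (I - {k})) * frame_wedge m I K)"
    unfolding frame_map_def sum_fun_apply
    by (rule sum.mono_neutral_cong_right) (auto simp: gen_mult_def)
  also have "\<dots> = (\<Sum>I | k \<notin> I. signed (inversions {k} I) (w I) * frame_wedge m (insert k I) K)"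
    by (rule sum.reindex_bij_witness[where i = "insert k" and j = "\<lambda>I. I - {k}"])
      (auto simp: insert_absorb)
  \<comment> \<open>The sets I that contain k may be added, since there the factor m k is
    repeated.\<close>
  also have "\<dots> = (\<Sum>I\<in>UNIV. w I * vec_mult (m k) (frame_wedge m I) K)"
    by (rule sum.mono_neutral_cong_left)
      (auto simp: vec_mult_frame_wedge signed_def)
  also have "\<dots> = vec_mult (m k) (frame_map m w) K"
    by (simp add: frame_map_def vec_mult_sum vec_mult_scale sum_fun_apply)
  finally show "frame_map m (gen_mult k w) K = vec_mult (m k) (frame_map m w) K" .
qed

text \<open>No sign arises: in a sorted list each generator is placed before larger ones
  only.\<close>

lemma foldr_gen_mult_scalar_form:
  assumes "sorted xs" "distinct xs"
  shows "foldr gen_mult xs (scalar_form a) K = (if K = set xs then a else 0)"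
  using assms
proof (induction xs arbitrary: K)
  case Nil
  then show ?case by (simp add: scalar_form_def)
next
  case (Cons x xs)
  have "inversions {x} (set xs) = 0"
    using Cons.prems by (auto simp: inversions_singleton card_eq_0_iff)
  moreover have "K = insert x (set xs) \<longleftrightarrow> x \<in> K \<and> K - {x} = set xs"
    using Cons.prems by auto
  ultimately show ?case
    using Cons by (auto simp: gen_mult_def signed_def)
qed

lemma frame_map_vec_mult_dual:
  assumes "\<And>k i. (\<Sum>s\<in>UNIV. m k s * m' s i) = (if k = i then 1 else 0)"
  shows "frame_map m' (vec_mult (m k) u) = gen_mult k (frame_map m' u)"
proof
  fix K
  have "frame_map m' (vec_mult (m k) u) K = (\<Sum>s\<in>UNIV. m k s * vec_mult (m' s) (frame_map m' u) K)"
    by (simp add: vec_mult_eq_sum[of "m k"] frame_map_sum frame_map_scale frame_map_gen_mult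
        sum_fun_apply)
  also have "\<dots> = (\<Sum>i\<in>UNIV. (\<Sum>s\<in>UNIV. m k s * m' s i) * gen_mult i (frame_map m' u) K)"
    unfolding vec_mult_def sum_distrib_left sum_distrib_right
    by (subst sum.swap) (simp add: mult.assoc)
  finally show "frame_map m' (vec_mult (m k) u) K = gen_mult k (frame_map m' u) K"
    by (simp add: assms if_distrib[of "\<lambda>x. x * _"] cong: if_cong)
qed

text \<open>Functoriality in place of the Cauchy-Binet identity: \<open>frame_map m'\<close> sends
  row k of m to the k-th generator, hence each product of rows to the matching product of
  generators.\<close>

lemma frame_map_inverse:
  assumes "\<And>k i. (\<Sum>s\<in>UNIV. m k s * m' s i) = (if k = i then 1 else 0)"
  shows "frame_map m' (frame_map m w) = w"
proof
  fix K
  have one: "frame_map m' (scalar_form 1) = scalar_form 1"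
  proof
    fix K
    have "frame_map m' (scalar_form 1) K = (\<Sum>I\<in>UNIV. if I = {} then frame_wedge m' I K else 0)"
      unfolding frame_map_def sum_fun_apply by (intro sum.cong refl) (auto simp: scalar_form_def)
    then show "frame_map m' (scalar_form 1) K = scalar_form 1 K"
      by (simp add: frame_wedge_def)
  qed
  have "frame_map m' (foldr (\<lambda>i. vec_mult (m i)) xs (scalar_form 1)) =
      foldr gen_mult xs (scalar_form 1)" for xs
    by (induction xs) (simp_all add: one frame_map_vec_mult_dual[OF assms])
  then have "frame_map m' (frame_wedge m I) K = (if K = I then 1 else 0)" for I
    by (simp add: frame_wedge_def foldr_gen_mult_scalar_form)
  then have "frame_map m' (frame_map m w) K = (\<Sum>I\<in>UNIV. w I * (if K = I then 1 else 0))"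
    by (simp add: frame_map_def[of m] frame_map_sum frame_map_scale sum_fun_apply)
  then show "frame_map m' (frame_map m w) K = w K"
    by (simp add: if_distrib cong: if_cong)
qed

section \<open>Lie derivatives and the Schouten-Nijenhuis bracket\<close>

lemma wedge_add_left: "wedge (u + v) w = wedge u w + wedge v w"
  by (simp add: fun_eq_iff wedge_def distrib_right signed_add sum.distrib)

lemma wedge_diff_left: "wedge (u - v) w = wedge u w - wedge v w"
  by (rule additive.diff[of "\<lambda>u. wedge u w", OF additive.intro]) (rule wedge_add_left)

lemma wedge_vec_mult_one: "wedge (vec_mult v (scalar_form 1)) w = vec_mult v w"
  by (simp add: wedge_vec_mult scalar_form_wedge)

lemma vec_mult_diff_left: "vec_mult (\<lambda>t. u t - v t) w = vec_mult u w - vec_mult v w"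
  by (simp add: fun_eq_iff vec_mult_def left_diff_distrib sum_subtractf)

lemma vec_mult_sum_left:
  "vec_mult (\<lambda>t. \<Sum>s\<in>A. a s * b s t) w K = (\<Sum>s\<in>A. a s * vec_mult (b s) w K)"
  unfolding vec_mult_def sum_distrib_left sum_distrib_right
  by (subst sum.swap) (simp add: mult.assoc)

section \<open>Partial derivatives as derivations of the rational functions\<close>

lemma pderiv_fract_add: "pderiv_fract s (f + g) = pderiv_fract s f + pderiv_fract s g"
proof -
  obtain a b where f: "f = Fract a b" and b: "b \<noteq> 0" by (cases f)
  obtain c d where g: "g = Fract c d" and d: "d \<noteq> 0" by (cases g)
  show ?thesis
    using b d
    by (simp add: f g pderiv_fract_Fract pderiv_poly_mult pderiv_poly_add eq_fract)
      (simp add: algebra_simps)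
qed

lemma pderiv_fract_sum: "pderiv_fract s (\<Sum>x\<in>A. f x) = (\<Sum>x\<in>A. pderiv_fract s (f x))"
  by (rule additive.sum[of "pderiv_fract s", OF additive.intro]) (rule pderiv_fract_add)

lemma pderiv_fract_minus: "pderiv_fract s (- f) = - pderiv_fract s f"
  by (rule additive.minus[of "pderiv_fract s", OF additive.intro]) (rule pderiv_fract_add)

lemma pderiv_fract_signed: "pderiv_fract s (signed k f) = signed k (pderiv_fract s f)"
  by (simp add: signed_def pderiv_fract_minus)

lemma pderiv_fract_const: "pderiv_fract s (Fract (Poly_Mapping.single 0 c) 1) = 0"
  by (simp add: pderiv_fract_Fract_1 pderiv_poly_single Zero_fract_def)

lemma pderiv_fract_one: "pderiv_fract s 1 = 0"
  using pderiv_fract_const[of s 1] by (simp add: One_fract_def)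

definition fract_vf :: "('n \<Rightarrow> 'n mpoly) \<Rightarrow> 'n \<Rightarrow> 'n::{finite,linorder} mpoly fract"
  where "fract_vf V s = Fract (V s) 1"

definition fract_vf_apply ::
    "('n \<Rightarrow> 'n mpoly fract) \<Rightarrow> 'n mpoly fract \<Rightarrow> 'n::{finite,linorder} mpoly fract"
  where "fract_vf_apply v g = (\<Sum>s\<in>UNIV. v s * pderiv_fract s g)"

text \<open>This is the Schouten-Nijenhuis bracket [v, Q] for a vector field v: its right derivative
  with respect to s is the scalar v s.\<close>

definition lie_derivative :: "('n \<Rightarrow> 'n mpoly fract) \<Rightarrow> 'n::{finite,linorder} mvf \<Rightarrow> 'n mvf"
  where "lie_derivative v Q K =
    (\<Sum>s\<in>UNIV. v s * pderiv_fract s (Q K) -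
      vec_mult (\<lambda>t. pderiv_fract s (v t)) (left_deriv s Q) K)"

lemma mvf_of_vf_eq_vec_mult:
  fixes V :: "'n::{finite,linorder} \<Rightarrow> 'n mpoly"
  shows "mvf_of_vf V = vec_mult (fract_vf V) (scalar_form 1)"
proof
  fix I :: "'n set"
  have "gen_mult s (scalar_form 1) I = (if I = {s} then 1 else 0 :: 'n mpoly fract)" for s
    by (auto simp: gen_mult_def scalar_form_def signed_def)
  then show "mvf_of_vf V I = vec_mult (fract_vf V) (scalar_form 1) I"
    unfolding mvf_of_vf_def vec_mult_def fract_vf_def by (intro sum.cong refl) auto
qed

lemma wedge_mvf_of_vf: "wedge (mvf_of_vf V) w = vec_mult (fract_vf V) w"
  by (simp add: mvf_of_vf_eq_vec_mult wedge_vec_mult_one)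

lemma mvf_pderiv_gen_mult: "mvf_pderiv s (gen_mult t w) = gen_mult t (mvf_pderiv s w)"
  by (auto simp: mvf_pderiv_def gen_mult_def pderiv_fract_signed)

lemma mvf_pderiv_vec_mult:
  "mvf_pderiv s (vec_mult v w) = vec_mult (\<lambda>t. pderiv_fract s (v t)) w + vec_mult v (mvf_pderiv s w)"
proof
  fix K
  have "pderiv_fract s (gen_mult t w K) = gen_mult t (mvf_pderiv s w) K" for t
    using fun_cong[OF mvf_pderiv_gen_mult, of s t w K] by (simp add: mvf_pderiv_def)
  then show "mvf_pderiv s (vec_mult v w) K =
      (vec_mult (\<lambda>t. pderiv_fract s (v t)) w + vec_mult v (mvf_pderiv s w)) K"
    by (simp add: mvf_pderiv_def vec_mult_def pderiv_fract_sum pderiv_fract_mult sum.distrib)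
qed

lemma mvf_pderiv_scalar_one: "mvf_pderiv s (scalar_form 1) = 0"
  by (auto simp: mvf_pderiv_def scalar_form_def pderiv_fract_one)

lemma left_deriv_scalar_form: "left_deriv s (scalar_form a) = 0"
  by (auto simp: left_deriv_def scalar_form_def)

lemma vec_mult_lie_derivative:
  "vec_mult u (lie_derivative v Q) K =
    (\<Sum>s\<in>UNIV. v s * vec_mult u (mvf_pderiv s Q) K -
      vec_mult u (vec_mult (\<lambda>t. pderiv_fract s (v t)) (left_deriv s Q)) K)"
proof -
  have "lie_derivative v Q = (\<Sum>s\<in>UNIV. (\<lambda>K. v s * mvf_pderiv s Q K) -
      vec_mult (\<lambda>t. pderiv_fract s (v t)) (left_deriv s Q))"
    by (simp add: fun_eq_iff lie_derivative_def mvf_pderiv_def sum_fun_apply)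
  then show ?thesis
    by (simp add: vec_mult_sum vec_mult_diff vec_mult_scale sum_fun_apply)
qed

text \<open>A graded Leibniz rule in the first argument, which reduces the bracket with a bivector
  to Lie derivatives. The right derivative of V \<and> W supplies their transport terms, the
  derivative of its coefficients the remaining ones.\<close>

lemma sn_bracket_wedge_vf:
  "sn_bracket (wedge (mvf_of_vf V) (mvf_of_vf W)) Q =
    vec_mult (fract_vf V) (lie_derivative (fract_vf W) Q) -
    vec_mult (fract_vf W) (lie_derivative (fract_vf V) Q)"
proof
  fix K
  define v w where "v = fract_vf V" and "w = fract_vf W"
  let ?P = "wedge (mvf_of_vf V) (mvf_of_vf W)"
  let ?v = "\<lambda>s t. pderiv_fract s (v t)" and ?w = "\<lambda>s t. pderiv_fract s (w t)"
  have R: "right_deriv s ?P = (\<lambda>I. w s * mvf_of_vf V I) - (\<lambda>I. v s * mvf_of_vf W I)" for s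
    by (auto simp: fun_eq_iff right_deriv_wedge_vf v_def w_def fract_vf_def mult.commute
        simp del: mult_fract)
  have 1: "wedge (right_deriv s ?P) (mvf_pderiv s Q) K =
      w s * vec_mult v (mvf_pderiv s Q) K - v s * vec_mult w (mvf_pderiv s Q) K" for s
    unfolding R by (simp add: wedge_diff_left wedge_scale_left wedge_mvf_of_vf v_def w_def)
  have P: "?P = vec_mult v (vec_mult w (scalar_form 1))"
    by (simp add: wedge_mvf_of_vf v_def w_def mvf_of_vf_eq_vec_mult[of W])
  have "mvf_pderiv s ?P = vec_mult (?v s) (vec_mult w (scalar_form 1)) +
      vec_mult v (vec_mult (?w s) (scalar_form 1))" for s
    by (simp add: P mvf_pderiv_vec_mult mvf_pderiv_scalar_one)
  \<comment> \<open>Moving the differentiated v behind w costs the minus sign of the second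
    term.\<close>
  then have 2: "wedge (mvf_pderiv s ?P) (left_deriv s Q) K =
      vec_mult v (vec_mult (?w s) (left_deriv s Q)) K - vec_mult w (vec_mult (?v s) (left_deriv s Q)) K"
    for s
    by (simp add: wedge_diff_left wedge_vec_mult scalar_form_wedge
        vec_mult_anticommute[of "?v s"])
  show "sn_bracket ?P Q K =
      (vec_mult (fract_vf V) (lie_derivative (fract_vf W) Q) -
       vec_mult (fract_vf W) (lie_derivative (fract_vf V) Q)) K"
    unfolding v_def[symmetric] w_def[symmetric]
    by (simp add: sn_bracket_def sum_fun_apply 1 2 vec_mult_lie_derivative
        sum_subtractf algebra_simps sum.distrib)
qed

text \<open>The Leibniz rule with [v, u] in components. Two signs cancel in the last term: one from
  \<open>left_deriv\<close> passing u, one from the derivative of v passing u.\<close>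

lemma lie_derivative_vec_mult:
  "lie_derivative v (vec_mult u Q) =
    vec_mult (\<lambda>t. fract_vf_apply v (u t) - fract_vf_apply u (v t)) Q + vec_mult u (lie_derivative v Q)"
proof
  fix K
  let ?v = "\<lambda>s t. pderiv_fract s (v t)" and ?u = "\<lambda>s t. pderiv_fract s (u t)"
  have 1: "pderiv_fract s (vec_mult u Q K) = vec_mult (?u s) Q K + vec_mult u (mvf_pderiv s Q) K" for s
    using fun_cong[OF mvf_pderiv_vec_mult, of s u Q K] by (simp add: mvf_pderiv_def)
  have "left_deriv s (vec_mult u Q) = (\<lambda>K. u s * Q K) - vec_mult u (left_deriv s Q)" for s
    by (simp add: fun_eq_iff left_deriv_vec_mult)
  then have 2: "vec_mult (?v s) (left_deriv s (vec_mult u Q)) K =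
      u s * vec_mult (?v s) Q K + vec_mult u (vec_mult (?v s) (left_deriv s Q)) K" for s
    by (simp add: vec_mult_diff vec_mult_scale vec_mult_anticommute[of "?v s"])
  have 3: "vec_mult (\<lambda>t. fract_vf_apply v (u t) - fract_vf_apply u (v t)) Q K =
      (\<Sum>s\<in>UNIV. v s * vec_mult (?u s) Q K) - (\<Sum>s\<in>UNIV. u s * vec_mult (?v s) Q K)"
    by (simp add: vec_mult_diff_left fract_vf_apply_def vec_mult_sum_left)
  show "lie_derivative v (vec_mult u Q) K =
      (vec_mult (\<lambda>t. fract_vf_apply v (u t) - fract_vf_apply u (v t)) Q +
       vec_mult u (lie_derivative v Q)) K"
    by (simp add: lie_derivative_def[of _ "vec_mult u Q"] 1 2 3 vec_mult_lie_derivative distrib_left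
        sum.distrib sum_subtractf)
qed

lemma lie_derivative_mult:
  "lie_derivative v (\<lambda>I. g * Q I) = (\<lambda>I. fract_vf_apply v g * Q I + g * lie_derivative v Q I)"
proof
  fix K
  have "left_deriv s (\<lambda>I. g * Q I) = (\<lambda>I. g * left_deriv s Q I)" for s
    by (simp add: fun_eq_iff left_deriv_scale)
  then show "lie_derivative v (\<lambda>I. g * Q I) K = fract_vf_apply v g * Q K + g * lie_derivative v Q K"
    by (simp add: lie_derivative_def fract_vf_apply_def pderiv_fract_mult vec_mult_scale
        sum_distrib_left sum_distrib_right sum.distrib sum_subtractf algebra_simps)
qed

lemma lie_derivative_frame_wedge:
  assumes "\<And>i t. fract_vf_apply v (m i t) = fract_vf_apply (m i) (v t)"
  shows "lie_derivative v (frame_wedge m I) = 0"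
proof -
  have one: "lie_derivative v (scalar_form 1) = 0"
    by (auto simp: fun_eq_iff lie_derivative_def left_deriv_scalar_form scalar_form_def
        pderiv_fract_one)
  have step: "lie_derivative v (vec_mult (m i) Q) = vec_mult (m i) (lie_derivative v Q)" for i Q
    unfolding lie_derivative_vec_mult vec_mult_diff_left assms by simp
  have "lie_derivative v (foldr (\<lambda>i. vec_mult (m i)) xs (scalar_form 1)) = 0" for xs
    by (induction xs) (simp_all add: one step flip: zero_fun_def)
  then show ?thesis
    by (simp add: frame_wedge_def)
qed

section \<open>Vector fields on functions, and commuting fields\<close>

lemma fract_vf_apply_Fract: "fract_vf_apply (fract_vf V) (Fract f 1) = Fract (vf_apply V f) 1"
  by (simp add: fract_vf_apply_def fract_vf_def vf_apply_def Fract_sum_1 pderiv_fract_Fract_1)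

lemma fract_vf_apply_mult:
  "fract_vf_apply v (f * g) = fract_vf_apply v f * g + f * fract_vf_apply v g"
  by (simp add: fract_vf_apply_def pderiv_fract_mult distrib_left sum.distrib sum_distrib_left
      sum_distrib_right ac_simps)

text \<open>The argument is the coordinate function x_t. Testing operators on it turns their
  commutation into equations between components.\<close>

lemma vf_apply_variable:
  "vf_apply V (Poly_Mapping.single (Poly_Mapping.single t 1) 1) = V t"
proof -
  have "pderiv_poly s (Poly_Mapping.single (Poly_Mapping.single t 1) 1) = (if s = t then 1 else 0)"
    for s :: 'a
    by (auto simp: pderiv_poly_single lookup_single)
  then show ?thesis
    by (simp add: vf_apply_def if_distrib[of "\<lambda>x. _ * x"] cong: if_cong)
qed

lemma vf_commute_components:
  assumes "vf_commute V W"
  shows "vf_apply V (W t) = vf_apply W (V t)"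
  using assms unfolding vf_commute_def by (metis vf_apply_variable)

lemma Y_wedge_eq_frame_wedge: "Y_wedge l = frame_wedge (\<lambda>i. fract_vf (Yf l i))"
proof -
  have "(\<lambda>i. wedge (mvf_of_vf (Yf l i))) = (\<lambda>i. vec_mult (fract_vf (Yf l i)))"
    by (rule ext)+ (simp add: wedge_mvf_of_vf)
  then show ?thesis
    by (intro ext) (simp add: Y_wedge_def frame_wedge_def)
qed

lemma lie_derivative_Y_wedge:
  assumes "\<And>i j. vf_commute (Yf l i) (Yf l j)"
  shows "lie_derivative (fract_vf (Yf l j)) (Y_wedge l I) = 0"
  unfolding Y_wedge_eq_frame_wedge
  by (rule lie_derivative_frame_wedge)
    (simp add: fract_vf_def[of "Yf l _"] fract_vf_apply_Fract vf_commute_components[OF assms])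

section \<open>The bracket with the Poisson tensor\<close>

lemma sn_bracket_add_left: "sn_bracket (P + P') Q = sn_bracket P Q + sn_bracket P' Q"
proof -
  have "right_deriv s (P + P') = right_deriv s P + right_deriv s P'"
    "mvf_pderiv s (P + P') = mvf_pderiv s P + mvf_pderiv s P'" for s
    by (auto simp: fun_eq_iff right_deriv_def mvf_pderiv_def signed_add pderiv_fract_add)
  then show ?thesis
    by (simp add: sn_bracket_def wedge_add_left sum.distrib[symmetric] algebra_simps)
qed

lemma sn_bracket_sum_left: "sn_bracket (\<Sum>x\<in>A. f x) Q = (\<Sum>x\<in>A. sn_bracket (f x) Q)"
  by (rule additive.sum[of "\<lambda>P. sn_bracket P Q", OF additive.intro]) (rule sn_bracket_add_left)

lemma sn_bracket_mvf_scale_left: "sn_bracket (mvf_scale c P) Q = mvf_scale c (sn_bracket P Q)"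
proof -
  let ?c = "Fract (Poly_Mapping.single 0 c) 1 :: 'a mpoly fract"
  have "right_deriv s (\<lambda>I. ?c * P I) = (\<lambda>I. ?c * right_deriv s P I)"
    "mvf_pderiv s (\<lambda>I. ?c * P I) = (\<lambda>I. ?c * mvf_pderiv s P I)" for s
    by (auto simp: fun_eq_iff right_deriv_def mvf_pderiv_def mult_signed pderiv_fract_mult
        pderiv_fract_const)
  then have "sn_bracket (\<lambda>I. ?c * P I) Q K = ?c * sn_bracket P Q K" for K
    by (simp add: sn_bracket_def wedge_scale_left sum_fun_apply sum_distrib_left
        right_diff_distrib)
  then show ?thesis
    by (simp add: mvf_scale_def fun_eq_iff)
qed

text \<open>By skewness the term with d i * e j is the term of the swapped pair (j, i), so the sum
  over i < j becomes one over all ordered pairs with i \<noteq> j. Collecting e i produces the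
  coefficients of X_i.\<close>

lemma sum_skew_pairs:
  fixes a :: "'n::{finite,linorder} \<Rightarrow> 'n \<Rightarrow> 'a::comm_ring_1"
  assumes "\<And>i j. a j i = - a i j"
  shows "(\<Sum>(i, j)\<in>{(i, j). i < j}. a i j * (d j * e i - d i * e j)) =
    (\<Sum>i\<in>UNIV. (\<Sum>j\<in>UNIV - {i}. a i j * d j) * e i)"
proof -
  let ?f = "\<lambda>(i, j). a i j * d j * e i"
  have neg: "a i j * x * y = - (a j i * x * y)" for i j x y
    by (subst assms) simp
  have "(\<Sum>i\<in>UNIV. (\<Sum>j\<in>UNIV - {i}. a i j * d j) * e i) = (\<Sum>p\<in>Sigma UNIV (\<lambda>i. UNIV - {i}). ?f p)"
    by (simp add: sum_distrib_right sum.Sigma)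
  also have "Sigma UNIV (\<lambda>i. UNIV - {i}) = {(i, j). i < j} \<union> {(i, j :: 'n). j < i}"
    by auto
  also have "(\<Sum>p\<in>\<dots>. ?f p) = (\<Sum>p\<in>{(i, j). i < j}. ?f p) + (\<Sum>p\<in>{(i, j). j < i}. ?f p)"
    by (rule sum.union_disjoint) auto
  also have "(\<Sum>p\<in>{(i, j). j < i}. ?f p) = (\<Sum>(i, j)\<in>{(i, j). i < j}. - (a i j * d i * e j))"
    by (rule sum.reindex_bij_witness[where i = prod.swap and j = prod.swap])
      (auto, metis neg)
  also have "(\<Sum>p\<in>{(i, j). i < j}. ?f p) + (\<Sum>(i, j)\<in>{(i, j). i < j}. - (a i j * d i * e j)) =
      (\<Sum>(i, j)\<in>{(i, j). i < j}. a i j * (d j * e i - d i * e j))"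
    unfolding sum.distrib[symmetric] by (rule sum.cong) (auto simp: algebra_simps)
  finally show ?thesis ..
qed

lemma sn_bracket_Poisson_tensor:
  assumes commute: "\<And>i j. vf_commute (Yf l i) (Yf l j)"
    and skew: "\<And>i j. \<alpha> j i = - \<alpha> i j"
  shows "sn_bracket (Poisson_tensor l \<alpha>) (\<lambda>K. g * Y_wedge l I K) K =
    (\<Sum>k\<in>UNIV. fract_vf_apply (fract_vf (Xf l \<alpha> k)) g * vec_mult (fract_vf (Yf l k)) (Y_wedge l I) K)"
proof -
  let ?y = "\<lambda>i. fract_vf (Yf l i)"
  define a where "a i j = (Fract (Poly_Mapping.single 0 (\<alpha> i j)) 1 :: 'a mpoly fract)" for i j
  define d where "d i = fract_vf_apply (?y i) g" for i
  define e where "e i = vec_mult (?y i) (Y_wedge l I) K" for i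
  have a: "a j i = - a i j" for i j
    by (simp add: a_def skew[of i j] single_uminus)
  \<comment> \<open>The Lie derivatives fall on g alone, because they annihilate
    \<open>Y_wedge l I\<close>.\<close>
  have "sn_bracket (wedge (mvf_of_vf (Yf l i)) (mvf_of_vf (Yf l j))) (\<lambda>K. g * Y_wedge l I K) K =
      d j * e i - d i * e j" for i j
    by (simp add: sn_bracket_wedge_vf lie_derivative_mult lie_derivative_Y_wedge[OF commute]
        vec_mult_scale d_def e_def)
  then have "sn_bracket (Poisson_tensor l \<alpha>) (\<lambda>K. g * Y_wedge l I K) K =
      (\<Sum>(i, j)\<in>{(i, j). i < j}. a i j * (d j * e i - d i * e j))"
    unfolding Poisson_tensor_def sn_bracket_sum_left sum_fun_apply
    by (intro sum.cong refl) (auto simp: sn_bracket_mvf_scale_left a_def fun_cong[OF mvf_scale_def])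
  also have "\<dots> = (\<Sum>k\<in>UNIV. (\<lambda>k. \<Sum>j\<in>UNIV - {k}. a k j * d j) k * e k)"
    unfolding sum_skew_pairs[of a, OF a] ..
  also have "(\<lambda>k. \<Sum>j\<in>UNIV - {k}. a k j * d j) =
      (\<lambda>k. fract_vf_apply (fract_vf (Xf l \<alpha> k)) g)"
  proof
    fix k
    have "fract_vf (Xf l \<alpha> k) s = (\<Sum>j\<in>UNIV - {k}. a k j * ?y j s)" for s
      by (simp add: fract_vf_def Xf_def poly_scale_def Fract_sum_1 a_def)
    then show "(\<Sum>j\<in>UNIV - {k}. a k j * d j) = fract_vf_apply (fract_vf (Xf l \<alpha> k)) g"
      unfolding fract_vf_apply_def d_def sum_distrib_left
      by (simp add: sum_distrib_right mult.assoc) (rule sum.swap)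
  qed
  finally show ?thesis
    by (simp add: e_def)
qed

section \<open>The divergence of a frame of commuting fields\<close>

lemma derivation_prod:
  fixes d :: "'a::comm_ring_1 \<Rightarrow> 'a"
  assumes "d 1 = 0" "\<And>x y. d (x * y) = d x * y + x * d y" "finite S"
  shows "d (\<Prod>i\<in>S. f i) = (\<Sum>i\<in>S. d (f i) * (\<Prod>j\<in>S - {i}. f j))"
  using \<open>finite S\<close>
proof induction
  case (insert x S)
  have "(\<Sum>i\<in>S. d (f i) * (\<Prod>j\<in>insert x S - {i}. f j)) =
      (\<Sum>i\<in>S. f x * (d (f i) * (\<Prod>j\<in>S - {i}. f j)))"
  proof (rule sum.cong[OF refl])
    fix i assume "i \<in> S"
    then have "insert x S - {i} = insert x (S - {i})" "x \<notin> S - {i}"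
      using insert.hyps by auto
    then show "d (f i) * (\<Prod>j\<in>insert x S - {i}. f j) = f x * (d (f i) * (\<Prod>j\<in>S - {i}. f j))"
      using insert.hyps by (simp add: ac_simps)
  qed
  then show ?case
    using insert by (simp add: assms(2) sum_distrib_left)
qed (simp add: assms(1))

text \<open>Differentiating one row at a time, only the diagonal term \<open>A\<^sub>i\<^sub>i m\<^sub>i\<close> of the new row
  \<open>i\<close> survives, the others repeating an old row.\<close>

lemma derivation_det:
  fixes d :: "'a::comm_ring_1 \<Rightarrow> 'a" and m :: "'a^'n^'n"
  assumes add: "\<And>x y. d (x + y) = d x + d y"
    and mult: "\<And>x y. d (x * y) = d x * y + x * d y"
    and m: "\<And>i j. d (m $ i $ j) = (\<Sum>t\<in>UNIV. A i t * m $ t $ j)"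
  shows "d (det m) = (\<Sum>i\<in>UNIV. A i i) * det m"
proof -
  interpret d: additive d by standard (rule add)
  have one: "d 1 = 0"
    using mult[of 1 1] by simp
  \<comment> \<open>A derivation kills the integers, in particular the signs of permutations in the
    Leibniz expansion.\<close>
  have "d (of_nat k) = 0" for k
    by (induction k) (simp_all add: d.zero add one)
  then have of_int: "d (of_int k) = 0" for k
    by (cases k) (simp_all add: d.minus d.diff one)
  have row: "det (\<chi> j. if j = i then (\<chi> c. d (m $ i $ c)) else m $ j) = A i i * det m" for i
  proof -
    have "(\<chi> c. d (m $ i $ c)) = (\<Sum>t\<in>UNIV. A i t *s m $ t)"
      by (simp add: vec_eq_iff m)
    then have "det (\<chi> j. if j = i then (\<chi> c. d (m $ i $ c)) else m $ j) =
        (\<Sum>t\<in>UNIV. A i t * det (\<chi> j. if j = i then m $ t else m $ j))"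
      by (simp only: det_linear_row_sum[OF finite] det_row_mul)
    also have "\<dots> = (\<Sum>t\<in>UNIV. if t = i then A i i * det m else 0)"
    proof (rule sum.cong[OF refl])
      fix t
      show "A i t * det (\<chi> j. if j = i then m $ t else m $ j) = (if t = i then A i i * det m else 0)"
      proof (cases "t = i")
        case True
        then have "(\<chi> j. if j = i then m $ t else m $ j) = m"
          by (simp add: vec_eq_iff)
        then show ?thesis
          using True by simp
      next
        case False
        have "det (\<chi> j. if j = i then m $ t else m $ j) = 0"
          by (rule det_identical_rows[of i t]) (use False in \<open>auto simp: row_def vec_eq_iff\<close>)
        then show ?thesis
          using False by simp
      qed
    qed
    finally show ?thesis by simp
  qed
  have "d (det m) = (\<Sum>p | p permutes UNIV. of_int (sign p) *
      (\<Sum>i\<in>UNIV. d (m $ i $ p i) * (\<Prod>j\<in>UNIV - {i}. m $ j $ p j)))"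
    unfolding det_def d.sum
    by (simp add: mult of_int derivation_prod[of d, OF one mult])
  also have "\<dots> = (\<Sum>i\<in>UNIV. \<Sum>p | p permutes UNIV. of_int (sign p) *
      (d (m $ i $ p i) * (\<Prod>j\<in>UNIV - {i}. m $ j $ p j)))"
    unfolding sum_distrib_left by (rule sum.swap)
  also have "\<dots> = (\<Sum>i\<in>UNIV. det (\<chi> j. if j = i then (\<chi> c. d (m $ i $ c)) else m $ j))"
  proof -
    have "(\<Prod>j\<in>UNIV. (\<chi> j. if j = i then (\<chi> c. d (m $ i $ c)) else m $ j) $ j $ p j) =
        d (m $ i $ p i) * (\<Prod>j\<in>UNIV - {i}. m $ j $ p j)" for i p
      by (subst prod.remove[of _ i]) auto
    then show ?thesis
      unfolding det_def by simp
  qed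
  finally show ?thesis
    by (simp add: row sum_distrib_right)
qed

section \<open>Vector fields on polynomials and on the determinant\<close>

lemma vf_apply_add: "vf_apply V (f + g) = vf_apply V f + vf_apply V g"
  by (simp add: vf_apply_def pderiv_poly_add distrib_left sum.distrib)

lemma vf_apply_diff: "vf_apply V (f - g) = vf_apply V f - vf_apply V g"
  by (rule additive.diff[of "vf_apply V", OF additive.intro]) (rule vf_apply_add)

lemma vf_apply_sum: "vf_apply V (\<Sum>x\<in>A. f x) = (\<Sum>x\<in>A. vf_apply V (f x))"
  by (rule additive.sum[of "vf_apply V", OF additive.intro]) (rule vf_apply_add)

lemma vf_apply_mult: "vf_apply V (f * g) = vf_apply V f * g + f * vf_apply V g"
  by (simp add: vf_apply_def pderiv_poly_mult distrib_left sum.distrib sum_distrib_left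
      sum_distrib_right ac_simps)

text \<open>Commutation gives Y_k(l_is) = Y_i(l_ks) = \<Sum>t. l_it * d_t(l_ks). The Jacobian of Y_k
  thus mixes the entries of a column of l, while \<open>derivation_det\<close> expects rows; hence
  the transpose.\<close>

lemma vf_apply_det:
  fixes l :: "'n::{finite,linorder} poly_matrix"
  assumes "\<And>i j. vf_commute (Yf l i) (Yf l j)"
  shows "vf_apply (Yf l k) (det l) = divergence (Yf l k) * det l"
proof -
  have "vf_apply (Yf l k) (det (transpose l)) =
      (\<Sum>s\<in>UNIV. pderiv_poly s (Yf l k s)) * det (transpose l)"
  proof (rule derivation_det[where A = "\<lambda>s t. pderiv_poly t (Yf l k s)"])
    fix s i
    show "vf_apply (Yf l k) (transpose l $ s $ i) =
        (\<Sum>t\<in>UNIV. pderiv_poly t (Yf l k s) * transpose l $ t $ i)"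
      using vf_commute_components[OF assms, of k i s]
      by (simp add: transpose_def vf_apply_def Yf_def mult.commute)
  qed (rule vf_apply_add vf_apply_mult)+
  then show ?thesis
    by (simp add: divergence_def det_transpose)
qed

lemma pderiv_poly_scale: "pderiv_poly s (poly_scale c f) = poly_scale c (pderiv_poly s f)"
  by (simp add: poly_scale_def pderiv_poly_mult pderiv_poly_single)

lemma vf_apply_scale: "vf_apply V (poly_scale c f) = poly_scale c (vf_apply V f)"
  by (simp add: vf_apply_def pderiv_poly_scale)
    (simp add: poly_scale_def sum_distrib_left mult.left_commute)

lemma vf_apply_Xf:
  "vf_apply (Xf l \<alpha> i) f = (\<Sum>j\<in>UNIV - {i}. poly_scale (\<alpha> i j) (vf_apply (Yf l j) f))"
  unfolding vf_apply_def Xf_def poly_scale_def sum_distrib_left sum_distrib_right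
  by (subst sum.swap) (simp add: mult.assoc)

lemma divergence_Xf:
  "divergence (Xf l \<alpha> i) = (\<Sum>j\<in>UNIV - {i}. poly_scale (\<alpha> i j) (divergence (Yf l j)))"
  unfolding divergence_def Xf_def pderiv_poly_sum pderiv_poly_scale
  unfolding poly_scale_def sum_distrib_left
  by (rule sum.swap)

lemma vf_apply_Xf_det:
  fixes l :: "'n::{finite,linorder} poly_matrix"
  assumes "\<And>i j. vf_commute (Yf l i) (Yf l j)"
  shows "vf_apply (Xf l \<alpha> i) (det l) = divergence (Xf l \<alpha> i) * det l"
  by (simp add: vf_apply_Xf divergence_Xf vf_apply_det[OF assms] sum_distrib_right
      poly_scale_def mult.assoc)

section \<open>The operators \<open>X\<^sub>i - \<delta>\<^sub>i\<close> on homogeneous polynomials\<close>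

lemma hom_polys_iff:
  "f \<in> hom_polys r \<longleftrightarrow>
    (\<forall>m. Poly_Mapping.lookup f m \<noteq> 0 \<longrightarrow> (\<Sum>i\<in>UNIV. Poly_Mapping.lookup m i) = r)"
  by (auto simp: hom_polys_def in_keys_iff)

lemma hom_polys_zero [simp]: "0 \<in> hom_polys r"
  by (simp add: hom_polys_iff)

lemma hom_polys_add: "f \<in> hom_polys r \<Longrightarrow> g \<in> hom_polys r \<Longrightarrow> f + g \<in> hom_polys r"
  by (auto simp: hom_polys_iff lookup_add) (metis add.left_neutral)

lemma hom_polys_diff: "f \<in> hom_polys r \<Longrightarrow> g \<in> hom_polys r \<Longrightarrow> f - g \<in> hom_polys r"
  by (auto simp: hom_polys_iff lookup_minus) (metis diff_self)

lemma hom_polys_sum: "(\<And>x. x \<in> A \<Longrightarrow> f x \<in> hom_polys r) \<Longrightarrow> (\<Sum>x\<in>A. f x) \<in> hom_polys r"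
  by (induction A rule: infinite_finite_induct) (simp_all add: hom_polys_add)

lemma hom_polys_mult:
  assumes "f \<in> hom_polys p" "g \<in> hom_polys q"
  shows "f * g \<in> hom_polys (p + q)"
  unfolding hom_polys_def
proof (rule CollectI, rule ballI)
  fix m assume "m \<in> Poly_Mapping.keys (f * g)"
  then obtain a b where "m = a + b" "a \<in> Poly_Mapping.keys f" "b \<in> Poly_Mapping.keys g"
    using keys_mult[of f g] by blast
  then show "(\<Sum>i\<in>UNIV. Poly_Mapping.lookup m i) = p + q"
    using assms by (auto simp: hom_polys_def lookup_add sum.distrib)
qed

lemma hom_polys_scale:
  assumes "f \<in> hom_polys r"
  shows "poly_scale c f \<in> hom_polys r"
proof -
  have "Poly_Mapping.single 0 c \<in> hom_polys 0"
    by (auto simp: hom_polys_iff lookup_single when_def)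
  then show ?thesis
    using hom_polys_mult[OF _ assms] by (fastforce simp: poly_scale_def)
qed

lemma hom_polys_pderiv:
  assumes "f \<in> hom_polys r"
  shows "pderiv_poly s f \<in> hom_polys (r - 1)"
  unfolding pderiv_poly_def
proof (rule hom_polys_sum)
  fix m assume "m \<in> Poly_Mapping.keys f"
  then have r: "(\<Sum>i\<in>UNIV. Poly_Mapping.lookup m i) = r"
    using assms by (simp add: hom_polys_def)
  show "Poly_Mapping.single (m - Poly_Mapping.single s 1)
      (of_nat (Poly_Mapping.lookup m s) * Poly_Mapping.lookup f m) \<in> hom_polys (r - 1)"
  \<comment> \<open>Truncated subtraction lowers the degree only if s occurs in m; otherwise the
    coefficient is 0, and 0 is homogeneous of every degree.\<close>
  proof (cases "Poly_Mapping.lookup m s = 0")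
    case False
    have "(\<Sum>i\<in>UNIV. Poly_Mapping.lookup m i) =
        (\<Sum>i\<in>UNIV. Poly_Mapping.lookup (m - Poly_Mapping.single s 1) i + (if i = s then 1 else 0))"
      by (rule sum.cong) (use False in \<open>auto simp: lookup_minus lookup_single when_def\<close>)
    then have "(\<Sum>i\<in>UNIV. Poly_Mapping.lookup (m - Poly_Mapping.single s 1) i) = r - 1"
      using r by (simp add: sum.distrib)
    then show ?thesis
      by (auto simp: hom_polys_iff lookup_single when_def simp del: One_nat_def)
  qed simp
qed

lemma pderiv_poly_hom_polys_0:
  assumes "f \<in> hom_polys 0"
  shows "pderiv_poly s f = 0"
  unfolding pderiv_poly_def
proof (rule sum.neutral, rule ballI)
  fix m assume "m \<in> Poly_Mapping.keys f"
  then have "Poly_Mapping.lookup m s = 0"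
    using assms by (auto simp: hom_polys_def)
  then show "Poly_Mapping.single (m - Poly_Mapping.single s 1)
      (of_nat (Poly_Mapping.lookup m s) * Poly_Mapping.lookup f m) = 0"
    by simp
qed

lemma hom_polys_vf_apply:
  assumes "\<And>s. V s \<in> hom_polys 1" "f \<in> hom_polys r"
  shows "vf_apply V f \<in> hom_polys r"
\<comment> \<open>For r = 0 the degree count 1 + (r - 1) is 1 instead of r, but derivatives of
  constants vanish.\<close>
proof (cases "r = 0")
  case True
  then show ?thesis
    using assms by (simp add: vf_apply_def pderiv_poly_hom_polys_0)
next
  case False
  then show ?thesis
    using hom_polys_mult[OF assms(1) hom_polys_pderiv[OF assms(2)]]
    by (auto simp: vf_apply_def intro: hom_polys_sum)
qed

text \<open>The X_i commute as constant combinations of the Y_j. Subtracting \<delta>_i preserves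
  this because \<delta>_i has degree 0, so every X_j annihilates it.\<close>

lemma commuting_linear_operators_X_delta:
  fixes l :: "'n::{finite,linorder} poly_matrix"
  assumes linear: "\<And>i s. l $ i $ s \<in> hom_polys 1"
    and commute: "\<And>i j. vf_commute (Yf l i) (Yf l j)"
  shows "commuting_linear_operators poly_scale (hom_polys r) (X_delta l \<alpha>)"
proof -
  have X: "Xf l \<alpha> i s \<in> hom_polys 1" for i s
    unfolding Xf_def Yf_def by (intro hom_polys_sum hom_polys_scale linear)
  have div: "divergence (Xf l \<alpha> i) \<in> hom_polys 0" for i
    using hom_polys_pderiv[OF X] by (auto simp: divergence_def intro!: hom_polys_sum)
  have Xdiv: "vf_apply (Xf l \<alpha> i) (divergence (Xf l \<alpha> j)) = 0" for i j
    by (simp add: vf_apply_def pderiv_poly_hom_polys_0[OF div])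
  have XX: "vf_apply (Xf l \<alpha> i) (vf_apply (Xf l \<alpha> j) f) =
      vf_apply (Xf l \<alpha> j) (vf_apply (Xf l \<alpha> i) f)" for i j f
  proof -
    have expand: "vf_apply (Xf l \<alpha> i) (vf_apply (Xf l \<alpha> j) f) = (\<Sum>a\<in>UNIV - {i}. \<Sum>b\<in>UNIV - {j}.
        poly_scale (\<alpha> i a) (poly_scale (\<alpha> j b) (vf_apply (Yf l a) (vf_apply (Yf l b) f))))" for i j
      unfolding vf_apply_Xf[of l \<alpha> i]
      unfolding vf_apply_Xf[of l \<alpha> j] vf_apply_sum vf_apply_scale
      unfolding poly_scale_def sum_distrib_left ..
    have YY: "vf_apply (Yf l a) (vf_apply (Yf l b) f) =
        vf_apply (Yf l b) (vf_apply (Yf l a) f)" for a b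
      using commute by (simp add: vf_commute_def)
    have "vf_apply (Xf l \<alpha> i) (vf_apply (Xf l \<alpha> j) f) = (\<Sum>b\<in>UNIV - {j}. \<Sum>a\<in>UNIV - {i}.
        poly_scale (\<alpha> j b) (poly_scale (\<alpha> i a) (vf_apply (Yf l b) (vf_apply (Yf l a) f))))"
      unfolding expand[of i j]
      by (subst sum.swap, intro sum.cong refl) (simp add: poly_scale_def mult.left_commute YY)
    then show ?thesis
      unfolding expand[of j i] .
  qed
  have "X_delta l \<alpha> i u \<in> hom_polys r" if "u \<in> hom_polys r" for i u
    using hom_polys_mult[OF div that] hom_polys_vf_apply[OF X that]
    by (auto simp: X_delta_def intro!: hom_polys_diff)
  moreover have "X_delta l \<alpha> i (u + v) = X_delta l \<alpha> i u + X_delta l \<alpha> i v" for i u v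
    by (simp add: X_delta_def vf_apply_add distrib_left)
  moreover have "X_delta l \<alpha> i (poly_scale c u) = poly_scale c (X_delta l \<alpha> i u)" for i c u
    unfolding X_delta_def vf_apply_scale by (simp add: poly_scale_def algebra_simps)
  moreover have "X_delta l \<alpha> i (X_delta l \<alpha> j u) = X_delta l \<alpha> j (X_delta l \<alpha> i u)" for i j u
    using XX[of i j u]
    by (simp add: X_delta_def vf_apply_diff vf_apply_mult Xdiv algebra_simps)
  ultimately show ?thesis
    unfolding commuting_linear_operators_def by blast
qed

section \<open>Isomorphisms of cohomology spaces\<close>

text \<open>Every coset on the image side is the T-image of a coset, so \<open>vimage T\<close>
  undoes \<open>image T\<close>. Taking preimages gives the direction from potential cochains to
  Koszul cochains.\<close>

lemma linear_iso_quot_space: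
  assumes inj: "inj T" and add: "\<And>u v. T (u + v) = T u + T v"
    and scale: "\<And>c u. T (smul c u) = smul' c (T u)"
  shows "linear_iso (quot_space smul' (T ` Z) (T ` B)) (quot_space smul Z B) (vimage T)"
proof -
  have coset: "(+) (T z) ` T ` B = T ` (+) z ` B" for z
    by (auto simp: add image_image)
  then have carrier: "vcarrier (quot_space smul' (T ` Z) (T ` B)) =
      image T ` vcarrier (quot_space smul Z B)"
    by (simp add: quot_space_def image_image)
  have vimage_image: "T -` T ` S = S" for S
    using inj by (simp add: inj_vimage_image_eq)
  have "{s + t |s t. s \<in> T ` S \<and> t \<in> T ` U} = T ` {s + t |s t. s \<in> S \<and> t \<in> U}" for S U
    by (auto simp: image_iff) (metis add)+
  then have vadd: "vadd (quot_space smul' (T ` Z) (T ` B)) (T ` S) (T ` U) =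
      T ` vadd (quot_space smul Z B) S U" for S U
    by (simp add: quot_space_def)
  have "{smul' c s + b |s b. s \<in> T ` S \<and> b \<in> T ` B} =
      T ` {smul c s + b |s b. s \<in> S \<and> b \<in> B}" for c S
    by (auto simp: image_iff) (metis add scale)+
  then have vscale: "vscale (quot_space smul' (T ` Z) (T ` B)) c (T ` S) =
      T ` vscale (quot_space smul Z B) c S" for c S
    by (simp add: quot_space_def)
  have "bij_betw (vimage T) (vcarrier (quot_space smul' (T ` Z) (T ` B)))
      (vcarrier (quot_space smul Z B))"
    unfolding carrier by (rule bij_betw_byWitness[where f' = "image T"]) (auto simp: vimage_image)
  then show ?thesis
    unfolding linear_iso_def carrier by (simp add: vadd vscale vimage_image)
qed

lemma linear_iso_cohomology:
  assumes inj: "inj T" and add: "\<And>u v. T (u + v) = T u + T v"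
    and scale: "\<And>c u. T (smul c u) = smul' c (T u)"
    and C: "\<And>p. C' p = T ` C p" and d: "\<And>u. d' (T u) = T (d u)"
  shows "linear_iso (cohomology smul' C' d' p) (cohomology smul C d p) (vimage T)"
proof -
  \<comment> \<open>Together with injectivity this makes T reflect cocycles; it also matches the
    coboundaries {0} in degree 0.\<close>
  have zero: "T 0 = 0"
    using add[of 0 0] by simp
  then have "T u = 0 \<longleftrightarrow> u = 0" for u
    using inj by (metis injD)
  then have cocycles: "cocycles C' d' p = T ` cocycles C d p"
    by (auto simp: cocycles_def C d)
  have coboundaries: "coboundaries C' d' p = T ` coboundaries C d p"
    by (auto simp: coboundaries_def C d zero image_image split: nat.split)
  show ?thesis
    unfolding cohomology_def cocycles coboundaries
    by (rule linear_iso_quot_space[of T smul smul', OF inj add scale])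
qed

lemma linear_iso_direct_sum:
  assumes iso: "\<And>i. i \<in> A \<Longrightarrow> linear_iso (V i) (W i) (\<phi> i)"
  shows "linear_iso (direct_sum A V) (direct_sum A W) (\<lambda>u. \<lambda>i\<in>A. \<phi> i (u i))"
proof -
  let ?inv = "\<lambda>w. \<lambda>i\<in>A. inv_into (vcarrier (V i)) (\<phi> i) (w i)"
  have bij: "bij_betw (\<phi> i) (vcarrier (V i)) (vcarrier (W i))" if "i \<in> A" for i
    using iso[OF that] by (simp add: linear_iso_def)
  have "bij_betw (\<lambda>u. \<lambda>i\<in>A. \<phi> i (u i)) (\<Pi>\<^sub>E i\<in>A. vcarrier (V i)) (\<Pi>\<^sub>E i\<in>A. vcarrier (W i))"
  proof (rule bij_betw_byWitness[where f' = ?inv])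
    show "\<forall>u\<in>\<Pi>\<^sub>E i\<in>A. vcarrier (V i). ?inv (\<lambda>i\<in>A. \<phi> i (u i)) = u"
      by (auto simp: fun_eq_iff bij_betw_inv_into_left[OF bij] PiE_iff extensional_def)
    show "\<forall>w\<in>\<Pi>\<^sub>E i\<in>A. vcarrier (W i). (\<lambda>i\<in>A. \<phi> i (?inv w i)) = w"
      by (auto simp: fun_eq_iff bij_betw_inv_into_right[OF bij] PiE_iff extensional_def)
    show "(\<lambda>u. \<lambda>i\<in>A. \<phi> i (u i)) ` (\<Pi>\<^sub>E i\<in>A. vcarrier (V i)) \<subseteq> (\<Pi>\<^sub>E i\<in>A. vcarrier (W i))"
      using bij_betwE[OF bij] by (auto simp: PiE_iff)
    show "?inv ` (\<Pi>\<^sub>E i\<in>A. vcarrier (W i)) \<subseteq> (\<Pi>\<^sub>E i\<in>A. vcarrier (V i))"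
      using bij_betwE[OF bij_betw_inv_into[OF bij]] by (auto simp: PiE_iff)
  qed
  then show ?thesis
    using iso by (auto simp: linear_iso_def direct_sum_def PiE_iff intro!: restrict_ext)
qed

section \<open>Potential cochains as Koszul cochains\<close>

lemma Fract_add_same: "D \<noteq> 0 \<Longrightarrow> Fract (f + g) D = Fract f D + Fract g D"
  by (simp add: eq_fract distrib_right mult.assoc)

lemma Fract_mult_same: "D \<noteq> 0 \<Longrightarrow> Fract f D * Fract D 1 = Fract f 1"
  by (simp add: eq_fract)

lemma Fract_1_eq_0_iff: "Fract f 1 = 0 \<longleftrightarrow> f = 0"
  by (simp add: Zero_fract_def eq_fract)

lemma Fract_prod_1: "Fract (prod g A) 1 = (\<Prod>x\<in>A. Fract (g x) 1)"
proof (induction A rule: infinite_finite_induct)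
  case (insert x A)
  then show ?case
    using mult_fract[of "g x" 1 "prod g A" 1] by simp
qed (simp_all add: One_fract_def)

lemma Fract_of_int: "Fract (of_int k) 1 = of_int k"
proof -
  have nat: "Fract (of_nat j) 1 = (of_nat j :: 'a fract)" for j
    by (simp add: of_nat_fract)
  show ?thesis
  proof (cases k rule: int_cases)
    case (neg j)
    have "Fract (- of_nat (Suc j)) 1 = (- Fract (of_nat (Suc j)) 1 :: 'a fract)"
      by (rule minus_fract[symmetric])
    then show ?thesis
      by (simp only: neg of_int_minus of_int_of_nat_eq nat)
  qed (simp add: nat)
qed

lemma Fract_det:
  "Fract (det l) 1 = det (\<chi> i s. Fract (l $ i $ s) 1)"
  unfolding det_def Fract_sum_1
  by (intro sum.cong refl) (simp add: Fract_prod_1[symmetric] Fract_of_int[symmetric])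

text \<open>Apply V to (f / D) * D = f by the product rule and cancel D. The eigenvalue e of D is
  what is subtracted from V.\<close>

lemma fract_vf_apply_eigen:
  assumes "D \<noteq> 0" "vf_apply V D = e * D"
  shows "fract_vf_apply (fract_vf V) (Fract f D) = Fract (vf_apply V f - e * f) D"
proof -
  have "fract_vf_apply (fract_vf V) (Fract f D * Fract D 1) = Fract (vf_apply V f) 1"
    unfolding Fract_mult_same[OF assms(1)] by (rule fract_vf_apply_Fract)
  moreover have "Fract f D * Fract (e * D) 1 = Fract (e * f) 1"
    using assms by (simp add: eq_fract ac_simps)
  ultimately have "fract_vf_apply (fract_vf V) (Fract f D) * Fract D 1 =
      Fract (vf_apply V f) 1 - Fract (e * f) 1"
    unfolding fract_vf_apply_mult fract_vf_apply_Fract assms(2) by (simp only: eq_diff_eq)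
  also have "\<dots> = Fract (vf_apply V f - e * f) D * Fract D 1"
    using assms(1) by (simp add: Fract_mult_same del: mult_fract)
  finally show ?thesis
    using assms(1) by (simp add: Fract_1_eq_0_iff del: mult_fract)
qed

lemma wedge_add_right: "wedge u (v + w) = wedge u v + wedge u w"
  by (simp add: fun_eq_iff wedge_def distrib_left signed_add sum.distrib)

lemma sn_bracket_add_right: "sn_bracket P (Q + Q') = sn_bracket P Q + sn_bracket P Q'"
proof -
  have "mvf_pderiv s (Q + Q') = mvf_pderiv s Q + mvf_pderiv s Q'" for s
    by (auto simp: fun_eq_iff mvf_pderiv_def pderiv_fract_add)
  then show ?thesis
    by (simp add: sn_bracket_def wedge_add_right left_deriv_add sum.distrib[symmetric] algebra_simps)
qed

lemma sn_bracket_sum_right: "sn_bracket P (\<Sum>x\<in>A. f x) = (\<Sum>x\<in>A. sn_bracket P (f x))"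
  by (rule additive.sum[of "sn_bracket P", OF additive.intro]) (rule sn_bracket_add_right)

definition potential_of_koszul :: "'n::{finite,linorder} poly_matrix \<Rightarrow> ('n set \<Rightarrow> 'n mpoly) \<Rightarrow> 'n mvf"
  where "potential_of_koszul l w =
    frame_map (\<lambda>i. fract_vf (Yf l i)) (\<lambda>I. Fract (w I) (det l))"

lemma potential_of_koszul_eq:
  "potential_of_koszul l w = (\<Sum>I\<in>UNIV. (\<lambda>K. Fract (w I) (det l) * Y_wedge l I K))"
  by (simp add: potential_of_koszul_def frame_map_def Y_wedge_eq_frame_wedge)

lemma potential_of_koszul_add:
  assumes "det l \<noteq> 0"
  shows "potential_of_koszul l (u + w) = potential_of_koszul l u + potential_of_koszul l w"
proof -
  have "(\<lambda>I. Fract ((u + w) I) (det l)) = (\<lambda>I. Fract (u I) (det l)) + (\<lambda>I. Fract (w I) (det l))"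
    using assms by (intro ext) (simp add: Fract_add_same del: add_fract)
  then show ?thesis
    by (simp only: potential_of_koszul_def frame_map_add)
qed

lemma potential_of_koszul_scale:
  "potential_of_koszul l (\<lambda>I. poly_scale c (w I)) = mvf_scale c (potential_of_koszul l w)"
proof -
  have "(\<lambda>I. Fract (poly_scale c (w I)) (det l)) =
      (\<lambda>I. Fract (Poly_Mapping.single 0 c) 1 * Fract (w I) (det l))"
    by (simp add: poly_scale_def)
  then show ?thesis
    by (simp only: potential_of_koszul_def frame_map_scale mvf_scale_def)
qed

lemma inj_potential_of_koszul:
  fixes l :: "'n::{finite,linorder} poly_matrix"
  assumes "det l \<noteq> 0"
  shows "inj (potential_of_koszul l)"
proof -
  \<comment> \<open>Over the field of fractions a nonzero determinant suffices for an inverse B,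
    whose rows express the coordinate fields in the frame Y.\<close>
  define M :: "(('n mpoly fract, 'n) vec, 'n) vec" where "M = (\<chi> i s. Fract (l $ i $ s) 1)"
  have "det M \<noteq> 0"
    using assms unfolding M_def Fract_det[symmetric] Fract_1_eq_0_iff .
  then obtain B where B: "M ** B = mat 1"
    by (auto simp: invertible_det_nz[symmetric] invertible_def)
  have "(\<Sum>s\<in>UNIV. fract_vf (Yf l k) s * B $ s $ i) = (if k = i then 1 else 0)" for k i
  proof -
    have "(M ** B) $ k $ i = (if k = i then 1 else 0)"
      by (simp add: B mat_def)
    then show ?thesis
      by (simp add: matrix_matrix_mult_def M_def fract_vf_def Yf_def del: mult_fract)
  qed
  then have inverse: "frame_map (\<lambda>s i. B $ s $ i) (potential_of_koszul l w) =
      (\<lambda>I. Fract (w I) (det l))" for w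
    unfolding potential_of_koszul_def by (rule frame_map_inverse)
  show ?thesis
  proof (rule injI)
    fix u w assume "potential_of_koszul l u = potential_of_koszul l w"
    then have "(\<lambda>I. Fract (u I) (det l)) = (\<lambda>I. Fract (w I) (det l))"
      by (metis inverse)
    then show "u = w"
      using assms by (simp add: fun_eq_iff eq_fract)
  qed
qed

lemma potential_cochains_eq:
  fixes l :: "'n::{finite,linorder} poly_matrix"
  shows "potential_cochains l r p = potential_of_koszul l ` koszul_cochains (hom_polys r) p"
proof -
  have eq: "potential_of_koszul l (\<lambda>I. if card I = p then f I else 0) =
      (\<Sum>I | card I = p. (\<lambda>K. Fract (f I) (det l) * Y_wedge l I K))" for f
  proof -
    \<comment> \<open>A fraction with denominator 0 is 0 by convention, which settles the first
      case.\<close>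
    have "Fract 0 (det l) = 0"
      by (cases "det l = 0") (simp_all add: Zero_fract_def eq_fract)
    then show ?thesis
      unfolding potential_of_koszul_eq
      by (intro ext, unfold sum_fun_apply, intro sum.mono_neutral_cong_right) auto
  qed
  have "(koszul_cochains (hom_polys r) p :: ('n set \<Rightarrow> 'n mpoly) set) =
      (\<lambda>f I. if card I = p then f I else 0) ` {f. \<forall>I. f I \<in> hom_polys r}"
  proof (intro equalityI subsetI)
    fix w :: "'n set \<Rightarrow> 'n mpoly" assume "w \<in> koszul_cochains (hom_polys r) p"
    then have w: "if card I = p then w I \<in> hom_polys r else w I = 0" for I
      by (simp add: koszul_cochains_def)
    have "w I = (if card I = p then w I else 0)" for I
      using w[of I] by (simp split: if_splits)
    then have "w = (\<lambda>I. if card I = p then w I else 0)"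
      by (rule ext)
    \<comment> \<open>The cochain w is its own preimage under truncation: its values outside degree
      p are 0, hence homogeneous of degree r.\<close>
    moreover have "w I \<in> hom_polys r" for I
      using w[of I] by (simp split: if_splits)
    ultimately show "w \<in> (\<lambda>f I. if card I = p then f I else 0) ` {f. \<forall>I. f I \<in> hom_polys r}"
      by blast
  qed (auto simp: koszul_cochains_def)
  then show ?thesis
    by (auto simp: potential_cochains_def image_image eq)
qed

lemma sn_bracket_potential_of_koszul:
  assumes commute: "\<And>i j. vf_commute (Yf l i) (Yf l j)"
    and D: "det l \<noteq> 0"
    and skew: "\<And>i j. \<alpha> j i = - \<alpha> i j"
  shows "sn_bracket (Poisson_tensor l \<alpha>) (potential_of_koszul l w) =
    potential_of_koszul l (koszul_differential (X_delta l \<alpha>) w)"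
proof
  fix K
  let ?y = "\<lambda>i. fract_vf (Yf l i)"
  have X: "fract_vf_apply (fract_vf (Xf l \<alpha> k)) (Fract f (det l)) = Fract (X_delta l \<alpha> k f) (det l)"
    for k f
    using D vf_apply_Xf_det[OF commute] by (simp add: fract_vf_apply_eigen X_delta_def)
  \<comment> \<open>Division by D respects 0 and negation, so it commutes with the signs in
    \<open>gen_mult\<close>.\<close>
  have gen: "potential_of_koszul l (gen_mult k u) = vec_mult (?y k) (potential_of_koszul l u)" for k u
  proof -
    have "Fract 0 (det l) = 0" "Fract (- f) (det l) = - Fract f (det l)" for f
      using D by (simp_all add: Zero_fract_def eq_fract)
    then have "(\<lambda>I. Fract (gen_mult k u I) (det l)) = gen_mult k (\<lambda>I. Fract (u I) (det l))"
      by (intro ext) (simp add: gen_mult_def signed_def)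
    then show ?thesis
      by (simp add: potential_of_koszul_def frame_map_gen_mult)
  qed
  have "sn_bracket (Poisson_tensor l \<alpha>) (potential_of_koszul l w) K =
      (\<Sum>I\<in>UNIV. \<Sum>k\<in>UNIV. Fract (X_delta l \<alpha> k (w I)) (det l) * vec_mult (?y k) (Y_wedge l I) K)"
    unfolding potential_of_koszul_eq sn_bracket_sum_right sum_fun_apply
    by (simp only: sn_bracket_Poisson_tensor[of l \<alpha>, OF commute skew] X)
  also have "\<dots> = (\<Sum>k\<in>UNIV. vec_mult (?y k) (potential_of_koszul l (\<lambda>I. X_delta l \<alpha> k (w I))) K)"
    unfolding potential_of_koszul_eq vec_mult_sum vec_mult_scale sum_fun_apply by (rule sum.swap)
  also have "\<dots> = potential_of_koszul l (koszul_differential (X_delta l \<alpha>) w) K"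
  proof -
    have "potential_of_koszul l (\<Sum>k\<in>A. f k) = (\<Sum>k\<in>A. potential_of_koszul l (f k))"
      for f :: "'a \<Rightarrow> 'a set \<Rightarrow> 'a mpoly" and A
      by (rule additive.sum[of "potential_of_koszul l", OF additive.intro])
        (rule potential_of_koszul_add[OF D])
    then show ?thesis
      by (simp add: koszul_differential_def gen sum_fun_apply)
  qed
  finally show "sn_bracket (Poisson_tensor l \<alpha>) (potential_of_koszul l w) K =
    potential_of_koszul l (koszul_differential (X_delta l \<alpha>) w) K" .
qed

text \<open>The first conjunct provides the data for which the Koszul differential squares to zero.
  The shape of the isomorphism records that it preserves the degree p; each component is the
  preimage under the same map.\<close>

theorem theorem5:
  fixes l :: "'n::{finite,linorder} poly_matrix"
    and \<alpha> :: "'n \<Rightarrow> 'n \<Rightarrow> real"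
    and r :: nat
  assumes linear: "\<And>i s. l $ i $ s \<in> hom_polys 1"
    and commute: "\<And>i j. vf_commute (Yf l i) (Yf l j)"
    and D_nonzero: "det l \<noteq> 0"
    and skew: "\<And>i j. \<alpha> j i = - \<alpha> i j"
  shows "commuting_linear_operators poly_scale (hom_polys r) (X_delta l \<alpha>) \<and>
    (\<exists>\<phi>. linear_iso
       (LH l (Poisson_tensor l \<alpha>) r)
       (KH poly_scale (X_delta l \<alpha>) (hom_polys r))
       (\<lambda>u. \<lambda>p\<in>{..CARD('n)}. \<phi> p (u p)))"
proof
  show "commuting_linear_operators poly_scale (hom_polys r) (X_delta l \<alpha>)"
    by (rule commuting_linear_operators_X_delta) fact+
  have "linear_iso
      (cohomology mvf_scale (potential_cochains l r) (sn_bracket (Poisson_tensor l \<alpha>)) p)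
      (cohomology (\<lambda>c w I. poly_scale c (w I)) (koszul_cochains (hom_polys r))
        (koszul_differential (X_delta l \<alpha>)) p)
      (vimage (potential_of_koszul l))" for p
    by (rule linear_iso_cohomology)
      (use D_nonzero in \<open>simp_all add: inj_potential_of_koszul potential_of_koszul_add
        potential_of_koszul_scale potential_cochains_eq
        sn_bracket_potential_of_koszul[of l \<alpha>, OF commute D_nonzero skew]\<close>)
  then show "\<exists>\<phi>. linear_iso
      (LH l (Poisson_tensor l \<alpha>) r)
      (KH poly_scale (X_delta l \<alpha>) (hom_polys r))
      (\<lambda>u. \<lambda>p\<in>{..CARD('n)}. \<phi> p (u p))"
    unfolding LH_def KH_def by (intro exI linear_iso_direct_sum)
qed

end
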